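(* Let $G$ be a wheel-free graph of order $n\geq 4$. Then $$\rho_A(G)\leq \rho_A(H_n),$$ with equality holding if and only if $G=H_n$ when $n\neq 7$, and $G=H_7$ or $G=F$ when $n=7$ (equality of graphs meaning isomorphism).
   Context: All graphs are finite, simple and undirected; the order of a graph is its number of vertices. $\rho_A(G)$ denotes the largest eigenvalue of the adjacency matrix $A(G)$ of $G$. $K_n$ and $C_n$ denote the complete graph and the cycle on $n$ vertices. $G\cup H$ is the disjoint union of graphs, $kG$ is the disjoint union of $k$ copies of $G$ ($k\ge 0$), and $G\nabla H$ is the graph obtained from the disjoint union $G\cup H$ by adding all edges between $G$ and $H$. For $\ell\geq 4$, the wheel graph on $\ell$ vertices is $W_\ell=K_1\nabla C_{\ell-1}$ (so $W_4=K_4$). A graph is wheel-free if it does not contain any $W_\ell$, $\ell\ge 4$, as a (not necessarily induced) subgraph. The graph $H_n$ is defined by $$ H_n=\left\{ \begin{array}{ll} \frac{n-1}{4}K_2 \nabla \frac{n+1}{2}K_1 & \text{if } n\equiv 1 \bmod 4, \\ \frac{n+1}{4}K_2 \nabla \frac{n-1}{2}K_1 & \text{if } n\equiv 3 \bmod 4, \\ \frac{n}{4}K_2 \nabla \frac{n}{2}K_1 & \text{if } n\equiv 0 \bmod 4, \\ \left(\frac{n-2}{4}K_2\cup K_1\right) \nabla \frac{n}{2}K_1 & \text{if } n\equiv 2 \bmod 4, \end{array} \right. $$ where in each case the multiples bind before $\nabla$, e.g. $\frac{n}{4}K_2\nabla\frac{n}{2}K_1=(\frac{n}{4}K_2)\nabla(\frac{n}{2}K_1)$.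 The graph $F$ is the complement of the cycle $C_7$. *)

theory Defs
  imports
    "Graph_Theory.Graph_Theory"
    "Jordan_Normal_Form.Spectral_Radius"
    "HOL-Library.Nat_Bijection"
begin

text \<open>
  A finite simple undirected graph is a \<^locale>\<open>pair_graph\<close>: a finite, symmetric, loop-free
  digraph whose arcs are ordered pairs, so that an edge \<open>uv\<close> is the pair of arcs
  \<open>(u, v)\<close>, \<open>(v, u)\<close>. Graph isomorphism is \<^const>\<open>digraph_iso\<close>.
\<close>

section \<open>Largest adjacency eigenvalue\<close>

definition adj_matrix :: "'a list \<Rightarrow> 'a pair_pre_digraph \<Rightarrow> real mat" where
  "adj_matrix vs G =
    mat (length vs) (length vs) (\<lambda>(i, j). if (vs ! i, vs ! j) \<in> parcs G then 1 else 0)"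

text \<open>
  The vertices are listed in an arbitrary order; by \<open>rho_A_enum\<close> below the choice is immaterial.
  The eigenvalues are the real ones, which for a symmetric real matrix are all of them.
\<close>

definition rho_A :: "'a pair_pre_digraph \<Rightarrow> real" where
  "rho_A G = Max (spectrum (adj_matrix (SOME vs. distinct vs \<and> set vs = pverts G) G))"

section \<open>Graph constructions\<close>

definition complete_graph :: "nat \<Rightarrow> nat pair_pre_digraph" where
  "complete_graph n = \<lparr>pverts = {..<n}, parcs = {(u, v). u < n \<and> v < n \<and> u \<noteq> v}\<rparr>"

text \<open>Meaningful for \<open>n \<ge> 3\<close> only.\<close>

definition cycle_graph :: "nat \<Rightarrow> nat pair_pre_digraph" where
  "cycle_graph n = \<lparr>pverts = {..<n},
     parcs = {(u, v). u < n \<and> v < n \<and> (v = (u + 1) mod n \<or> u = (v + 1) mod n)}\<rparr>"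

definition complement_graph :: "'a pair_pre_digraph \<Rightarrow> 'a pair_pre_digraph" where
  "complement_graph G = \<lparr>pverts = pverts G,
     parcs = {(u, v). u \<in> pverts G \<and> v \<in> pverts G \<and> u \<noteq> v \<and> (u, v) \<notin> parcs G}\<rparr>"

text \<open>
  The constructed graphs all have vertices in \<^typ>\<open>nat\<close>, so that graphs built in different ways
  share one type. Disjointness of the parts comes from the bijections \<^const>\<open>sum_encode\<close> from
  \<^typ>\<open>nat + nat\<close> and \<^const>\<open>prod_encode\<close> from \<^typ>\<open>nat \<times> nat\<close> to \<^typ>\<open>nat\<close>.
\<close>

definition graph_union ::
    "nat pair_pre_digraph \<Rightarrow> nat pair_pre_digraph \<Rightarrow> nat pair_pre_digraph" where
  "graph_union G H = \<lparr>pverts = sum_encode ` (pverts G <+> pverts H),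
     parcs = {(sum_encode (Inl u), sum_encode (Inl v)) |u v. (u, v) \<in> parcs G} \<union>
             {(sum_encode (Inr u), sum_encode (Inr v)) |u v. (u, v) \<in> parcs H}\<rparr>"

definition graph_join ::
    "nat pair_pre_digraph \<Rightarrow> nat pair_pre_digraph \<Rightarrow> nat pair_pre_digraph" where
  "graph_join G H = \<lparr>pverts = pverts (graph_union G H),
     parcs = parcs (graph_union G H) \<union>
       {(sum_encode (Inl u), sum_encode (Inr v)) |u v. u \<in> pverts G \<and> v \<in> pverts H} \<union>
       {(sum_encode (Inr v), sum_encode (Inl u)) |u v. u \<in> pverts G \<and> v \<in> pverts H}\<rparr>"

definition graph_copies :: "nat \<Rightarrow> nat pair_pre_digraph \<Rightarrow> nat pair_pre_digraph" where
  "graph_copies k G = \<lparr>pverts = prod_encode ` ({..<k} \<times> pverts G),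
     parcs = {(prod_encode (i, u), prod_encode (i, v)) |i u v. i < k \<and> (u, v) \<in> parcs G}\<rparr>"

definition wheel_graph :: "nat \<Rightarrow> nat pair_pre_digraph" where
  "wheel_graph l = graph_join (complete_graph 1) (cycle_graph (l - 1))"

definition contains_graph :: "'a pair_pre_digraph \<Rightarrow> 'b pair_pre_digraph \<Rightarrow> bool" where
  "contains_graph G H \<longleftrightarrow> (\<exists>S :: 'a pair_pre_digraph.
     subgraph (with_proj S) (with_proj G) \<and> digraph_iso (with_proj S) (with_proj H))"

definition wheel_free :: "'a pair_pre_digraph \<Rightarrow> bool" where
  "wheel_free G \<longleftrightarrow> (\<forall>l\<ge>4. \<not> contains_graph G (wheel_graph l))"

definition H_graph :: "nat \<Rightarrow> nat pair_pre_digraph" where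
  "H_graph n =
    (if n mod 4 = 1 then
       graph_join (graph_copies ((n - 1) div 4) (complete_graph 2))
                  (graph_copies ((n + 1) div 2) (complete_graph 1))
     else if n mod 4 = 3 then
       graph_join (graph_copies ((n + 1) div 4) (complete_graph 2))
                  (graph_copies ((n - 1) div 2) (complete_graph 1))
     else if n mod 4 = 0 then
       graph_join (graph_copies (n div 4) (complete_graph 2))
                  (graph_copies (n div 2) (complete_graph 1))
     else
       graph_join
         (graph_union (graph_copies ((n - 2) div 4) (complete_graph 2)) (complete_graph 1))
         (graph_copies (n div 2) (complete_graph 1)))"

definition F_graph :: "nat pair_pre_digraph" where
  "F_graph = complement_graph (cycle_graph 7)"

section \<open>Basic facts\<close>

lemma adj_matrix_carrier: "adj_matrix vs G \<in> carrier_mat (length vs) (length vs)"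
  by (simp add: adj_matrix_def)

lemma adj_matrix_mult_vec:
  assumes "distinct vs" "i < length vs"
  shows "(adj_matrix vs G *\<^sub>v vec (length vs) (\<lambda>j. f (vs ! j))) $ i =
    (\<Sum>w | w \<in> set vs \<and> (vs ! i, w) \<in> parcs G. f w)"
proof -
  let ?n = "length vs"
  have "(adj_matrix vs G *\<^sub>v vec ?n (\<lambda>j. f (vs ! j))) $ i =
      (\<Sum>j<?n. if (vs ! i, vs ! j) \<in> parcs G then f (vs ! j) else 0)"
    using assms(2)
    by (auto simp: adj_matrix_def scalar_prod_def atLeast0LessThan intro!: sum.cong)
  also have "\<dots> = (\<Sum>w\<in>set vs. if (vs ! i, w) \<in> parcs G then f w else 0)"
    using sum.reindex_bij_betw[OF bij_betw_nth[OF assms(1) refl refl],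
        of "\<lambda>w. if (vs ! i, w) \<in> parcs G then f w else 0"] by simp
  also have "\<dots> = (\<Sum>w | w \<in> set vs \<and> (vs ! i, w) \<in> parcs G. f w)"
    by (subst sum.inter_filter[symmetric]) auto
  finally show ?thesis .
qed

lemma eigenvalue_adj_matrix_iff:
  assumes "distinct vs"
  shows "eigenvalue (adj_matrix vs G) k \<longleftrightarrow>
    (\<exists>f. (\<exists>u\<in>set vs. f u \<noteq> 0) \<and>
         (\<forall>u\<in>set vs. (\<Sum>w | w \<in> set vs \<and> (u, w) \<in> parcs G. f w) = k * f u))"
    (is "?L \<longleftrightarrow> ?R")
proof
  let ?n = "length vs"
  have dr: "dim_row (adj_matrix vs G) = ?n"
    by (simp add: adj_matrix_def)
  {
    assume ?L
    then obtain v where v: "v \<in> carrier_vec ?n" "v \<noteq> 0\<^sub>v ?n"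
        "adj_matrix vs G *\<^sub>v v = k \<cdot>\<^sub>v v"
      unfolding eigenvalue_def eigenvector_def dr by blast
    define f where "f = (\<lambda>u. v $ (the_inv_into {..<?n} ((!) vs) u))"
    have f: "f (vs ! j) = v $ j" if "j < ?n" for j
      unfolding f_def using assms that
      by (subst the_inv_into_f_f) (auto simp: inj_on_def nth_eq_iff_index_eq)
    have veq: "vec ?n (\<lambda>j. f (vs ! j)) = v"
      using v(1) by (intro eq_vecI) (auto simp: f)
    obtain i where "i < ?n" "v $ i \<noteq> 0"
      using v(1,2) by (metis carrier_vecD eq_vecI index_zero_vec)
    then have "\<exists>u\<in>set vs. f u \<noteq> 0"
      using f by (metis nth_mem)
    moreover have "(\<Sum>w | w \<in> set vs \<and> (u, w) \<in> parcs G. f w) = k * f u"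
      if u: "u \<in> set vs" for u
    proof -
      obtain i where i: "i < ?n" "u = vs ! i"
        using u by (auto simp: in_set_conv_nth)
      show ?thesis
        using adj_matrix_mult_vec[OF assms i(1), of G f] v(1) i
        by (simp add: veq v(3) f[OF i(1)])
    qed
    ultimately show ?R by blast
  next
    assume ?R
    then obtain f where f: "\<exists>u\<in>set vs. f u \<noteq> 0"
        "\<And>u. u \<in> set vs \<Longrightarrow> (\<Sum>w | w \<in> set vs \<and> (u, w) \<in> parcs G. f w) = k * f u"
      by blast
    define v where "v = vec ?n (\<lambda>j. f (vs ! j))"
    have "v \<noteq> 0\<^sub>v ?n"
    proof -
      obtain i where "i < ?n" "f (vs ! i) \<noteq> 0"
        using f(1) by (auto simp: in_set_conv_nth)
      then have "v $ i \<noteq> 0\<^sub>v ?n $ i"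
        by (simp add: v_def)
      then show ?thesis by auto
    qed
    moreover have "adj_matrix vs G *\<^sub>v v = k \<cdot>\<^sub>v v"
    proof (rule eq_vecI)
      fix i assume "i < dim_vec (k \<cdot>\<^sub>v v)"
      then have i: "i < ?n" by (simp add: v_def)
      show "(adj_matrix vs G *\<^sub>v v) $ i = (k \<cdot>\<^sub>v v) $ i"
        using adj_matrix_mult_vec[OF assms i, of G f] f(2)[of "vs ! i"] i by (simp add: v_def)
    qed (simp add: v_def dr)
    ultimately show ?L
      unfolding eigenvalue_def eigenvector_def dr by (metis v_def vec_carrier)
  }
qed

lemma rho_A_enum:
  assumes "distinct vs" "set vs = pverts G"
  shows "rho_A G = Max (spectrum (adj_matrix vs G))"
proof -
  define ws where "ws = (SOME ws. distinct ws \<and> set ws = pverts G)"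
  have "distinct ws \<and> set ws = pverts G"
    unfolding ws_def by (rule someI[of _ vs]) (simp add: assms)
  then have ws: "distinct ws" "set ws = set vs"
    by (simp_all add: assms)
  have "eigenvalue (adj_matrix ws G) = eigenvalue (adj_matrix vs G)"
    by (intro ext) (simp only: eigenvalue_adj_matrix_iff[OF ws(1)]
        eigenvalue_adj_matrix_iff[OF assms(1)] ws(2))
  then have "spectrum (adj_matrix ws G) = spectrum (adj_matrix vs G)"
    by (simp only: spectrum_def)
  then show ?thesis
    by (simp add: rho_A_def ws_def)
qed

lemma pair_graph_iff:
  "pair_graph G \<longleftrightarrow> finite (pverts G) \<and> parcs G \<subseteq> pverts G \<times> pverts G \<and>
     sym (parcs G) \<and> irrefl (parcs G)" (is "?L \<longleftrightarrow> ?R")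
proof
  assume ?L
  then interpret pair_graph G .
  show ?R
    using pair_finite_verts arcs_symmetric no_loops' in_arcsD1 in_arcsD2
    by (auto simp: sym_def irrefl_def)
next
  assume R: ?R
  then have "finite (parcs G)"
    by (meson finite_SigmaI finite_subset)
  with R show ?L
    by unfold_locales (auto simp: symmetric_def irrefl_def)
qed

lemma pair_graph_complete_graph: "pair_graph (complete_graph n)"
  by (auto simp: pair_graph_iff complete_graph_def sym_def irrefl_def)

lemma pair_graph_cycle_graph: "n \<ge> 3 \<Longrightarrow> pair_graph (cycle_graph n)"
  by (auto simp: pair_graph_iff cycle_graph_def sym_def irrefl_def mod_Suc split: if_splits)

lemma pair_graph_complement_graph: "pair_graph G \<Longrightarrow> pair_graph (complement_graph G)"
  by (auto simp: pair_graph_iff complement_graph_def sym_def irrefl_def)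

lemma pair_graph_graph_union:
  "pair_graph G \<Longrightarrow> pair_graph H \<Longrightarrow> pair_graph (graph_union G H)"
  by (auto simp: pair_graph_iff graph_union_def sym_def irrefl_def sum_encode_eq)

lemma pair_graph_graph_join:
  "pair_graph G \<Longrightarrow> pair_graph H \<Longrightarrow> pair_graph (graph_join G H)"
  by (auto simp: pair_graph_iff graph_join_def graph_union_def sym_def irrefl_def sum_encode_eq)

lemma pair_graph_graph_copies: "pair_graph G \<Longrightarrow> pair_graph (graph_copies k G)"
  by (auto simp: pair_graph_iff graph_copies_def sym_def irrefl_def prod_encode_eq)

lemma pair_graph_wheel_graph: "l \<ge> 4 \<Longrightarrow> pair_graph (wheel_graph l)"
  by (simp add: wheel_graph_def pair_graph_graph_join pair_graph_complete_graph
      pair_graph_cycle_graph)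

lemma pair_graph_H_graph: "pair_graph (H_graph n)"
  by (simp add: H_graph_def pair_graph_graph_join pair_graph_graph_union pair_graph_graph_copies
      pair_graph_complete_graph)

lemma pair_graph_F_graph: "pair_graph F_graph"
  by (simp add: F_graph_def pair_graph_complement_graph pair_graph_cycle_graph)

lemma card_complete_graph: "card (pverts (complete_graph n)) = n"
  by (simp add: complete_graph_def)

lemma card_graph_union:
  assumes "finite (pverts G)" "finite (pverts H)"
  shows "card (pverts (graph_union G H)) = card (pverts G) + card (pverts H)"
proof -
  have "card (pverts (graph_union G H)) = card (pverts G <+> pverts H)"
    by (simp add: graph_union_def card_image[OF inj_sum_encode])
  with assms show ?thesis by (simp add: card_Plus)
qed

lemma card_graph_join:
  assumes "finite (pverts G)" "finite (pverts H)"
  shows "card (pverts (graph_join G H)) = card (pverts G) + card (pverts H)"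
  using card_graph_union[OF assms] by (simp add: graph_join_def)

lemma card_graph_copies: "card (pverts (graph_copies k G)) = k * card (pverts G)"
  by (simp add: graph_copies_def card_image[OF inj_prod_encode] card_cartesian_product)

lemma card_H_graph: "card (pverts (H_graph n)) = n"
proof -
  have fin: "finite (pverts (graph_copies k (complete_graph m)))"
      "finite (pverts (complete_graph m))"
      "finite (pverts (graph_union (graph_copies k (complete_graph m)) (complete_graph l)))"
    for k l m
    by (auto simp: graph_copies_def complete_graph_def graph_union_def)
  define q where "q = n div 4"
  have "n mod 4 < 4" by simp
  then have "n mod 4 = 0 \<or> n mod 4 = 1 \<or> n mod 4 = 2 \<or> n mod 4 = 3"
    by linarith
  then consider "n = 4 * q" | "n = 4 * q + 1" | "n = 4 * q + 2" | "n = 4 * q + 3"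
    using div_mult_mod_eq[of n 4] unfolding q_def by linarith
  then show ?thesis
  proof cases
    case 2
    then have "n mod 4 = 1" "(n - 1) div 4 = q" "(n + 1) div 2 = 2 * q + 1" by simp_all
    with 2 show ?thesis
      by (simp add: H_graph_def card_graph_join card_graph_copies card_complete_graph fin)
  next
    case 4
    then have "n mod 4 = 3" "(n + 1) div 4 = q + 1" "(n - 1) div 2 = 2 * q + 1" by simp_all
    with 4 show ?thesis
      by (simp add: H_graph_def card_graph_join card_graph_copies card_complete_graph fin)
  next
    case 1
    then have "n mod 4 = 0" "n div 4 = q" "n div 2 = 2 * q" by simp_all
    with 1 show ?thesis
      by (simp add: H_graph_def card_graph_join card_graph_copies card_complete_graph fin)
  next
    case 3
    then have "n mod 4 = 2" by presburger
    moreover from 3 have "(n - 2) div 4 = q" "n div 2 = 2 * q + 1" by simp_all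
    ultimately show ?thesis using 3
      by (simp add: H_graph_def card_graph_join card_graph_union card_graph_copies
          card_complete_graph fin)
  qed
qed

end

theory Submission
  imports Defs "HOL-Analysis.Function_Topology"
begin

text \<open>
  Write \<open>A\<close> for the adjacency matrix, \<open>N(u)\<close> for the neighbourhood of \<open>u\<close>, \<open>d\<close> for its size
  and \<open>\<rho>\<close> for the largest eigenvalue, with a nonnegative eigenvector \<open>x\<close>
  (\<open>rayleigh_maximizer\<close>).  The row sum of \<open>A\<^sup>2 - A\<close> at \<open>u\<close>, called the excess of \<open>u\<close>, is the sum of
  \<open>deg v - 1\<close> over the neighbours \<open>v\<close> of \<open>u\<close>.  As \<open>A\<close> is symmetric, \<open>\<rho>\<^sup>2 - \<rho>\<close> is the average of the
  excess with weights \<open>x\<close> (\<open>sum_mult_excess\<close>), so a bound on the excess bounds \<open>\<rho>\<close>.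

  A graph is wheel-free exactly if all neighbourhoods induce forests; in particular \<open>N(u)\<close> has at
  most \<open>d - 1\<close> edges.  If \<open>N(u)\<close> induces a matching, counting edges gives an excess of at most
  \<open>d (n - d)\<close>.  If \<open>N(u)\<close> contains a path \<open>a v c\<close>, then a vertex \<open>w\<close> outside \<open>N(u)\<close> other than \<open>u\<close>
  cannot be adjacent to all of \<open>a, v, c\<close>, as \<open>a u c w\<close> would be a \<open>4\<close>-cycle in \<open>N(v)\<close>; so each such \<open>w\<close>
  misses a vertex of \<open>N(u)\<close>, and this loss compensates the additional edges in \<open>N(u)\<close>.  In both cases
  the excess is at most \<open>n\<^sup>2 / 4\<close> (\<open>excess_le\<close>), whence \<open>\<rho> (\<rho> - 1) \<le> \<lfloor>n\<^sup>2 / 4\<rfloor>\<close>.  Unless \<open>n\<close> is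
  congruent to \<open>2\<close> modulo \<open>4\<close>, the graph \<open>H\<^sub>n\<close> attains this bound.

  In the case of equality every vertex in the support of \<open>x\<close> has maximal excess.  One such vertex
  whose neighbourhood induces a matching forces the graph to be \<open>H\<^sub>n\<close>
  (\<open>matching_type_tight_join\<close>).  If there is none, then \<open>n\<close> is odd, the graph is regular of degree
  \<open>(n + 1) / 2\<close>, and the vertices missed by the non-neighbours of a vertex determine it: only the
  complement of \<open>C\<^sub>7\<close> remains (\<open>all_path_type_complement_C7\<close>).

  For \<open>n = 2 h\<close> with \<open>h\<close> odd the bound \<open>h\<^sup>2\<close> on the excess is not attained on average.  Here
  \<open>\<rho>(H\<^sub>n)\<close> is the largest root of the cubic \<open>f(t) = t (t\<^sup>2 - t - h\<^sup>2) + h\<close>, and it suffices to see that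
  \<open>f(\<rho>) < 0\<close> for every competitor.  By the same averaging, applied once more, \<open>f(\<rho>)\<close> is negative if
  the defects \<open>h\<^sup>2 - excess\<close> of the neighbours of each vertex add up to at least \<open>h\<close>, and to more
  than \<open>h\<close> somewhere in the support of \<open>x\<close>.  If no defect vanishes, \<open>f(\<rho>) < 0\<close> is immediate for
  \<open>\<rho> > h\<close>, and \<open>\<rho> \<le> h\<close> is smaller than \<open>\<rho>(H\<^sub>n)\<close> anyway.  A vertex of defect \<open>0\<close> determines
  the graph almost completely, because all its non-neighbours miss the same vertex \<open>b\<close> of its
  neighbourhood, and the defects can be computed; only for \<open>n = 6\<close> one graph escapes this
  estimate and is treated with an explicit test vector (\<open>two_mod_four_dichotomy\<close>).
\<close>

section \<open>Adjacency operators and nonnegative eigenvectors\<close>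

locale simple_graph =
  fixes V :: "'a set" and E :: "'a rel"
  assumes finite_V: "finite V"
    and E_subset: "E \<subseteq> V \<times> V"
    and sym_E: "sym E"
    and irrefl_E: "irrefl E"
begin

definition nbh :: "'a \<Rightarrow> 'a set" where
  "nbh u = {v. (u, v) \<in> E}"

definition adj :: "('a \<Rightarrow> 'b::comm_monoid_add) \<Rightarrow> 'a \<Rightarrow> 'b" where
  "adj f u = (\<Sum>v\<in>nbh u. f v)"

lemma nbh_subset: "nbh u \<subseteq> V"
  using E_subset by (auto simp: nbh_def)

lemma finite_nbh [simp, intro]: "finite (nbh u)"
  using finite_V nbh_subset by (rule finite_subset[rotated])

lemma nbh_sym: "v \<in> nbh u \<longleftrightarrow> u \<in> nbh v"
  using sym_E by (auto simp: nbh_def sym_def)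

lemma not_in_nbh [simp]: "u \<notin> nbh u"
  using irrefl_E by (auto simp: nbh_def irrefl_def)

lemma adj_conv: "adj f u = (\<Sum>v\<in>V. if v \<in> nbh u then f v else 0)"
proof -
  have "nbh u = V \<inter> nbh u" using nbh_subset by blast
  then show ?thesis
    unfolding adj_def by (metis finite_V sum.inter_restrict)
qed

lemma adj_selfadjoint:
  fixes f g :: "'a \<Rightarrow> 'b::comm_semiring_0"
  shows "(\<Sum>u\<in>V. f u * adj g u) = (\<Sum>u\<in>V. adj f u * g u)"
proof -
  have "(\<Sum>u\<in>V. f u * adj g u) = (\<Sum>u\<in>V. \<Sum>v\<in>V. if v \<in> nbh u then f u * g v else 0)"
    by (simp add: adj_conv sum_distrib_left if_distrib cong: if_cong)
  also have "\<dots> = (\<Sum>v\<in>V. \<Sum>u\<in>V. if v \<in> nbh u then f u * g v else 0)"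
    by (rule sum.swap)
  also have "\<dots> = (\<Sum>v\<in>V. adj f v * g v)"
    by (auto simp: adj_conv sum_distrib_right if_distrib nbh_sym intro!: sum.cong cong: if_cong)
  finally show ?thesis .
qed

definition nonneg_eigenvector :: "('a \<Rightarrow> real) \<Rightarrow> real \<Rightarrow> bool" where
  "nonneg_eigenvector x r \<longleftrightarrow>
    (\<forall>u\<in>V. x u \<ge> 0) \<and> (\<exists>u\<in>V. x u > 0) \<and> (\<forall>u\<in>V. adj x u = r * x u)"

text \<open>
  The quadratic form attains its maximum on the unit sphere, and taking absolute values of the
  coordinates does not decrease it.  Varying one coordinate of a nonnegative maximizer shows that it is
  an eigenvector.  This yields at once that a real eigenvalue exists and that the largest one has a
  nonnegative eigenvector.
\<close>

lemma rayleigh_maximizer: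
  assumes "V \<noteq> {}"
  obtains x r where "nonneg_eigenvector x r"
    and "\<And>y :: 'a \<Rightarrow> real. (\<Sum>u\<in>V. y u * adj y u) \<le> r * (\<Sum>u\<in>V. (y u)\<^sup>2)"
proof -
  define Q where "Q y = (\<Sum>u\<in>V. y u * adj y u)" for y :: "'a \<Rightarrow> real"
  define q where "q y = (\<Sum>u\<in>V. (y u)\<^sup>2)" for y :: "'a \<Rightarrow> real"
  \<comment> \<open>Compactness is used in the product topology on functions, so that the coordinates outside
    the vertex set have to be pinned to \<open>0\<close>.\<close>
  define C where "C = PiE UNIV (\<lambda>u. if u \<in> V then {-1..1::real} else {0})"
  define S where "S = {y. q y = 1} \<inter> C"
  have "compactin (product_topology (\<lambda>_. euclidean) UNIV) C"
    unfolding C_def compactin_PiE by auto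
  then have "compact C"
    by (simp add: euclidean_product_topology)
  moreover have contq: "continuous_on UNIV q"
    unfolding q_def by (intro continuous_intros continuous_on_product_coordinates)
  then have "closed {y. q y = 1}"
    by (intro closed_Collect_eq) auto
  ultimately have "compact S"
    unfolding S_def by (intro closed_Int_compact)
  moreover have "S \<noteq> {}"
  proof -
    obtain a where a: "a \<in> V" using assms by blast
    have "q (\<lambda>u. if u = a then 1 else 0) = (\<Sum>u\<in>V. if u = a then 1 else 0)"
      unfolding q_def by (intro sum.cong) auto
    then have "(\<lambda>u. if u = a then 1 else 0) \<in> S"
      using a finite_V by (auto simp: S_def C_def)
    then show ?thesis by blast
  qed
  moreover have "continuous_on S Q"
  proof -
    have "continuous_on UNIV Q"
      unfolding Q_def adj_def by (intro continuous_intros continuous_on_product_coordinates)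
    then show ?thesis by (rule continuous_on_subset) simp
  qed
  ultimately obtain x0 where x0: "x0 \<in> S" "\<And>y. y \<in> S \<Longrightarrow> Q y \<le> Q x0"
    using continuous_attains_sup[of S Q] by blast
  define r where "r = Q x0"
  have Q_scale: "Q (\<lambda>u. c * y u) = c\<^sup>2 * Q y" and q_scale: "q (\<lambda>u. c * y u) = c\<^sup>2 * q y" for c y
    unfolding Q_def q_def adj_def
    by (simp_all add: sum_distrib_left algebra_simps power2_eq_square)
  have q_ge: "(y u)\<^sup>2 \<le> q y" if "u \<in> V" for u y
    unfolding q_def using that finite_V by (intro member_le_sum) auto
  have q_cong: "q y = q y'" and Q_cong: "Q y = Q y'" if "\<And>u. u \<in> V \<Longrightarrow> y u = y' u" for y y'
  proof -
    show "q y = q y'" unfolding q_def using that by (intro sum.cong) auto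
    have "adj y u = adj y' u" for u
      unfolding adj_def using that nbh_subset by (intro sum.cong) auto
    with that show "Q y = Q y'" unfolding Q_def by (intro sum.cong) auto
  qed
  have rayleigh: "Q y \<le> r * q y" for y
  proof (cases "q y = 0")
    case True
    then have "y u = 0" if "u \<in> V" for u
      using q_ge[OF that, of y] by simp
    then have "Q y = 0" unfolding Q_def by simp
    with True show ?thesis by simp
  next
    case False
    have "q y \<ge> 0" unfolding q_def by (intro sum_nonneg) auto
    with False have pos: "q y > 0" by simp
    define c where "c = 1 / sqrt (q y)"
    have c2: "c\<^sup>2 * q y = 1" unfolding c_def using pos by (simp add: power_divide)
    define z where "z = (\<lambda>u. if u \<in> V then c * y u else 0)"
    have z: "q z = c\<^sup>2 * q y" "Q z = c\<^sup>2 * Q y"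
      using q_cong[of z "\<lambda>u. c * y u"] Q_cong[of z "\<lambda>u. c * y u"]
      by (simp_all add: z_def q_scale Q_scale)
    have "\<bar>z u\<bar> \<le> 1" if "u \<in> V" for u
      using q_ge[OF that, of z] z c2 by (simp add: abs_square_le_1)
    then have "z \<in> S"
      unfolding S_def C_def using z c2 by (auto simp: abs_le_iff z_def)
    then have "c\<^sup>2 * Q y \<le> r" using x0(2) z r_def by metis
    then have "c\<^sup>2 * Q y * q y \<le> r * q y" using pos by (intro mult_right_mono) auto
    moreover have "c\<^sup>2 * Q y * q y = Q y" using c2 by (metis mult.assoc mult.commute mult_1_right)
    ultimately show ?thesis by simp
  qed
  define x where "x = (\<lambda>u. \<bar>x0 u\<bar>)"
  have qx: "q x = 1" using x0(1) unfolding S_def q_def x_def by simp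
  have Qx: "Q x = r"
  proof (rule antisym)
    show "Q x \<le> r" using rayleigh[of x] qx by simp
    have "Q x0 \<le> (\<Sum>u\<in>V. \<bar>x0 u * adj x0 u\<bar>)"
      unfolding Q_def by (intro sum_mono) auto
    also have "\<dots> \<le> Q x"
      unfolding Q_def x_def adj_def
      by (intro sum_mono) (auto simp: abs_mult intro!: mult_left_mono)
    finally show "r \<le> Q x" by (simp add: r_def)
  qed
  have eig: "adj x a = r * x a" if a: "a \<in> V" for a
  proof -
    define D where "D = adj x a - r * x a"
    define e where "e = (\<lambda>u. if u = a then 1 else 0 :: real)"
    have line: "2 * t * D \<le> r * t\<^sup>2" for t :: real
    proof -
      have adj_add: "adj (\<lambda>u. x u + t * e u) u = adj x u + t * adj e u" for u
        unfolding adj_def by (simp add: sum.distrib sum_distrib_left)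
      have "Q (\<lambda>u. x u + t * e u) =
          Q x + t * (\<Sum>u\<in>V. x u * adj e u) + t * (\<Sum>u\<in>V. e u * adj x u)
            + t\<^sup>2 * (\<Sum>u\<in>V. e u * adj e u)"
        unfolding Q_def adj_add
        by (simp add: algebra_simps sum.distrib sum_distrib_left power2_eq_square)
      also have "(\<Sum>u\<in>V. x u * adj e u) = (\<Sum>u\<in>V. e u * adj x u)"
        by (subst adj_selfadjoint) (simp add: mult.commute)
      also have "(\<Sum>u\<in>V. e u * adj x u) = (\<Sum>u\<in>V. if u = a then adj x a else 0)"
        unfolding e_def by (intro sum.cong) auto
      also have "\<dots> = adj x a" using a finite_V by simp
      also have "(\<Sum>u\<in>V. e u * adj e u) = (\<Sum>u\<in>V. if u = a then adj e a else 0)"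
        unfolding e_def by (intro sum.cong) auto
      also have "\<dots> = adj e a" using a finite_V by simp
      also have "adj e a = 0"
        unfolding adj_def e_def by (intro sum.neutral) auto
      finally have 1: "Q (\<lambda>u. x u + t * e u) = r + 2 * t * adj x a" by (simp add: Qx)
      have "q (\<lambda>u. x u + t * e u) = q x + (\<Sum>u\<in>V. if u = a then 2 * t * x a + t\<^sup>2 else 0)"
        unfolding q_def sum.distrib[symmetric] e_def
        by (intro sum.cong) (auto simp: power2_eq_square algebra_simps)
      also have "\<dots> = 1 + 2 * t * x a + t\<^sup>2" using a finite_V qx by simp
      finally show ?thesis
        using rayleigh[of "\<lambda>u. x u + t * e u"] 1 by (simp add: D_def algebra_simps)
    qed
    have "D = 0"
    proof (rule ccontr)
      assume "D \<noteq> 0"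
      define k where "k = \<bar>r\<bar> + 1"
      have k: "k > 0" "r < k * 2" unfolding k_def by auto
      have "2 * (D / k) * D \<le> r * (D / k)\<^sup>2" by (rule line)
      then have "2 * k * D\<^sup>2 \<le> r * D\<^sup>2"
        using k(1) by (simp add: power2_eq_square field_simps)
      with \<open>D \<noteq> 0\<close> k show False by simp
    qed
    then show ?thesis by (simp add: D_def)
  qed
  have "\<exists>u\<in>V. x u > 0"
  proof (rule ccontr)
    assume "\<not> ?thesis"
    then have "x u = 0" if "u \<in> V" for u using that unfolding x_def by auto
    then have "q x = 0" unfolding q_def by simp
    with qx show False by simp
  qed
  with eig have "nonneg_eigenvector x r" by (auto simp: nonneg_eigenvector_def x_def)
  with rayleigh show thesis unfolding Q_def q_def by (intro that)
qed

lemma eigenvector_pairing: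
  assumes "nonneg_eigenvector x r"
  shows "(\<Sum>u\<in>V. x u * adj y u) = r * (\<Sum>u\<in>V. x u * y u)"
proof -
  have "(\<Sum>u\<in>V. x u * adj y u) = (\<Sum>u\<in>V. adj x u * y u)" by (rule adj_selfadjoint)
  also have "\<dots> = (\<Sum>u\<in>V. r * (x u * y u))"
    using assms by (intro sum.cong) (auto simp: nonneg_eigenvector_def)
  finally show ?thesis by (simp add: sum_distrib_left)
qed

lemma eigenvector_weight_pos:
  assumes "nonneg_eigenvector x r" "\<And>u. u \<in> V \<Longrightarrow> y u > 0"
  shows "(\<Sum>u\<in>V. x u * y u) > 0"
proof -
  obtain a where a: "a \<in> V" "x a > 0" using assms(1) by (auto simp: nonneg_eigenvector_def)
  have "x a * y a > 0" using a assms(2) by simp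
  with a(1) show ?thesis
    using assms finite_V
    by (intro sum_pos2[of V a]) (auto simp: nonneg_eigenvector_def less_imp_le)
qed

text \<open>
  The upper half of the Collatz-Wielandt characterization of the spectral radius.
\<close>

lemma test_vector_bound:
  assumes x: "nonneg_eigenvector x r" and y: "\<And>u. u \<in> V \<Longrightarrow> y u > 0"
    and le: "\<And>u. u \<in> V \<Longrightarrow> adj y u \<le> k * y u"
  shows "r \<le> k"
proof -
  have "r * (\<Sum>u\<in>V. x u * y u) \<le> (\<Sum>u\<in>V. x u * (k * y u))"
    unfolding eigenvector_pairing[OF x, symmetric]
    using x le by (intro sum_mono mult_left_mono) (auto simp: nonneg_eigenvector_def)
  also have "\<dots> = k * (\<Sum>u\<in>V. x u * y u)"
    by (simp add: sum_distrib_left algebra_simps)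
  finally show ?thesis
    using eigenvector_weight_pos[OF x y] by simp
qed

text \<open>
  A positive eigenvector can only belong to the largest eigenvalue, since it is not orthogonal to a
  nonnegative one.  Spectral radii of concrete graphs are computed in this way.
\<close>

lemma positive_eigenvector_unique:
  assumes x: "nonneg_eigenvector x r" and y: "\<And>u. u \<in> V \<Longrightarrow> y u > 0"
    and eq: "\<And>u. u \<in> V \<Longrightarrow> adj y u = k * y u"
  shows "r = k"
proof -
  have pos: "(\<Sum>u\<in>V. x u * y u) > 0"
    using x y by (rule eigenvector_weight_pos)
  have "r * (\<Sum>u\<in>V. x u * y u) = (\<Sum>u\<in>V. x u * (k * y u))"
    unfolding eigenvector_pairing[OF x, symmetric] using eq by (intro sum.cong) auto
  also have "\<dots> = k * (\<Sum>u\<in>V. x u * y u)"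
    by (simp add: sum_distrib_left algebra_simps)
  finally show ?thesis using pos by simp
qed

end

lemma pair_graph_simple_graph: "pair_graph G \<Longrightarrow> simple_graph (pverts G) (parcs G)"
  by (simp add: pair_graph_iff simple_graph_def)

lemma rho_A_nonneg_eigenvector:
  assumes "pair_graph G" "pverts G \<noteq> {}"
  shows "\<exists>x. simple_graph.nonneg_eigenvector (pverts G) (parcs G) x (rho_A G)"
proof -
  interpret simple_graph "pverts G" "parcs G"
    using assms(1) by (rule pair_graph_simple_graph)
  obtain vs where vs: "distinct vs" "set vs = pverts G"
    using finite_distinct_list[OF finite_V] by blast
  obtain x r where x: "nonneg_eigenvector x r"
    and max: "\<And>y. (\<Sum>u\<in>pverts G. y u * adj y u) \<le> r * (\<Sum>u\<in>pverts G. (y u)\<^sup>2)"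
    using rayleigh_maximizer[OF assms(2)] by blast
  have nb: "{w. w \<in> pverts G \<and> (u, w) \<in> parcs G} = nbh u" for u
    using nbh_subset by (auto simp: nbh_def)
  have ev: "eigenvalue (adj_matrix vs G) k \<longleftrightarrow>
      (\<exists>f. (\<exists>u\<in>pverts G. f u \<noteq> 0) \<and> (\<forall>u\<in>pverts G. adj f u = k * f u))" for k
    unfolding eigenvalue_adj_matrix_iff[OF vs(1)] vs(2) nb adj_def ..
  have "Max (spectrum (adj_matrix vs G)) = r"
  proof (rule Max_eqI)
    show "finite (spectrum (adj_matrix vs G))"
      using card_finite_spectrum(1)[OF adj_matrix_carrier] .
    have "eigenvalue (adj_matrix vs G) r"
      unfolding ev using x
      by (intro exI[of _ x]) (force simp: nonneg_eigenvector_def)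
    then show "r \<in> spectrum (adj_matrix vs G)" by (simp add: spectrum_def)
  next
    fix k assume "k \<in> spectrum (adj_matrix vs G)"
    then have "eigenvalue (adj_matrix vs G) k" by (simp add: spectrum_def)
    then obtain f a where f: "\<And>u. u \<in> pverts G \<Longrightarrow> adj f u = k * f u"
        and a: "a \<in> pverts G" "f a \<noteq> 0"
      unfolding ev by blast
    have "(f a)\<^sup>2 \<le> (\<Sum>u\<in>pverts G. (f u)\<^sup>2)"
      using a finite_V by (intro member_le_sum) auto
    with a(2) have pos: "(\<Sum>u\<in>pverts G. (f u)\<^sup>2) > 0"
      by (smt (verit) zero_less_power2)
    have "k * (\<Sum>u\<in>pverts G. (f u)\<^sup>2) = (\<Sum>u\<in>pverts G. f u * adj f u)"
      unfolding sum_distrib_left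
      by (intro sum.cong) (auto simp: f power2_eq_square)
    also have "\<dots> \<le> r * (\<Sum>u\<in>pverts G. (f u)\<^sup>2)" by (rule max)
    finally show "k \<le> r" using pos by (rule mult_right_le_imp_le)
  qed
  then have "rho_A G = r" using rho_A_enum[OF vs] by simp
  with x show ?thesis by blast
qed

section \<open>Isomorphisms of simple graphs\<close>

text \<open>
  Arcs are pairs of vertices, so the arc part of an isomorphism is determined by its vertex part.
\<close>

lemma digraph_isoI:
  assumes G: "pair_graph G" and H: "pair_graph H"
    and f: "bij_betw f (pverts G) (pverts H)"
    and arcs: "\<And>u v. u \<in> pverts G \<Longrightarrow> v \<in> pverts G \<Longrightarrow>
      (u, v) \<in> parcs G \<longleftrightarrow> (f u, f v) \<in> parcs H"
  shows "digraph_iso (with_proj G) (with_proj H)"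
proof -
  define hom where "hom = \<lparr>iso_verts = f, iso_arcs = map_prod f f,
    iso_head = (snd :: 'b \<times> 'b \<Rightarrow> 'b), iso_tail = fst\<rparr>"
  have subG: "parcs G \<subseteq> pverts G \<times> pverts G" and subH: "parcs H \<subseteq> pverts H \<times> pverts H"
    using G H by (auto simp: pair_graph_iff)
  interpret G: pair_graph G by (rule G)
  have inj: "inj_on f (pverts G)" and im: "f ` pverts G = pverts H"
    using f by (auto simp: bij_betw_def)
  have "inj_on (map_prod f f) (parcs G)"
    using map_prod_inj_on[OF inj inj] subG by (rule inj_on_subset)
  then have "pre_digraph.digraph_isomorphism (with_proj G) hom"
    unfolding pre_digraph.digraph_isomorphism_def
    using inj G.wf_digraph by (simp add: hom_def)
  moreover have "parcs H = map_prod f f ` parcs G"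
  proof (intro equalityI subsetI)
    fix e assume e: "e \<in> parcs H"
    then obtain a b where ab: "e = (f a, f b)" "a \<in> pverts G" "b \<in> pverts G"
      using subH im by blast
    then have "(a, b) \<in> parcs G" using arcs e by blast
    then show "e \<in> map_prod f f ` parcs G" using ab by force
  next
    fix e assume "e \<in> map_prod f f ` parcs G"
    then show "e \<in> parcs H" using arcs subG by auto
  qed
  then have "with_proj H = app_iso hom (with_proj G)"
    by (simp add: hom_def app_iso_def im with_proj_def)
  ultimately show ?thesis by (auto simp: digraph_iso_def)
qed

lemma digraph_isoE:
  assumes "digraph_iso (with_proj G) (with_proj H)" and subG: "parcs G \<subseteq> pverts G \<times> pverts G"
  obtains f where "bij_betw f (pverts G) (pverts H)"
    and "\<And>u v. u \<in> pverts G \<Longrightarrow> v \<in> pverts G \<Longrightarrow>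
      (u, v) \<in> parcs G \<longleftrightarrow> (f u, f v) \<in> parcs H"
proof -
  obtain hom where hom: "pre_digraph.digraph_isomorphism (with_proj G) hom"
    and H: "with_proj H = app_iso hom (with_proj G)"
    using assms by (auto simp: digraph_iso_def)
  define f where "f = iso_verts hom"
  have verts: "pverts H = f ` pverts G" and harcs: "parcs H = iso_arcs hom ` parcs G"
    and tl: "iso_tail hom = fst" and hd: "iso_head hom = snd"
    using H by (simp_all add: app_iso_def with_proj_def f_def)
  have inj: "inj_on f (pverts G)"
    using hom by (simp add: pre_digraph.digraph_isomorphism_def f_def)
  have ia: "iso_arcs hom e = (f (fst e), f (snd e))" if "e \<in> parcs G" for e
    using hom that unfolding pre_digraph.digraph_isomorphism_def
    by (simp add: tl hd f_def prod_eq_iff)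
  show thesis
  proof (rule that[of f])
    show "bij_betw f (pverts G) (pverts H)" using inj verts by (simp add: bij_betw_def)
    fix u v assume uv: "u \<in> pverts G" "v \<in> pverts G"
    show "(u, v) \<in> parcs G \<longleftrightarrow> (f u, f v) \<in> parcs H"
    proof
      assume "(u, v) \<in> parcs G"
      then show "(f u, f v) \<in> parcs H" using ia unfolding harcs by force
    next
      assume "(f u, f v) \<in> parcs H"
      then obtain e where e: "e \<in> parcs G" "(f u, f v) = (f (fst e), f (snd e))"
        unfolding harcs using ia by auto
      moreover have "fst e \<in> pverts G" "snd e \<in> pverts G" using e(1) subG by auto
      ultimately have "fst e = u" "snd e = v" using uv inj
        by (auto simp: inj_on_eq_iff)
      then show "(u, v) \<in> parcs G" using e(1) by (metis prod.collapse)
    qed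
  qed
qed

lemma rho_A_iso:
  assumes "digraph_iso (with_proj G) (with_proj H)" and G: "pair_graph G"
  shows "rho_A G = rho_A H"
proof -
  have subG: "parcs G \<subseteq> pverts G \<times> pverts G" and fin: "finite (pverts G)"
    using G by (auto simp: pair_graph_iff)
  obtain f where f: "bij_betw f (pverts G) (pverts H)"
    and arcs: "\<And>u v. u \<in> pverts G \<Longrightarrow> v \<in> pverts G \<Longrightarrow>
      (u, v) \<in> parcs G \<longleftrightarrow> (f u, f v) \<in> parcs H"
    using digraph_isoE[OF assms(1) subG] by blast
  obtain vs where vs: "distinct vs" "set vs = pverts G"
    using finite_distinct_list[OF fin] by blast
  have "distinct (map f vs)" "set (map f vs) = pverts H"
    using vs f by (auto simp: distinct_map bij_betw_def)
  then have "rho_A H = Max (spectrum (adj_matrix (map f vs) H))" by (rule rho_A_enum)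
  moreover have "(f (vs ! i), f (vs ! j)) \<in> parcs H \<longleftrightarrow> (vs ! i, vs ! j) \<in> parcs G"
    if "i < length vs" "j < length vs" for i j
    using arcs that vs(2) by (metis nth_mem)
  then have "adj_matrix (map f vs) H = adj_matrix vs G"
    unfolding adj_matrix_def by (intro eq_matI) simp_all
  ultimately show ?thesis using rho_A_enum[OF vs] by simp
qed

section \<open>Wheel-free graphs have acyclic neighbourhoods\<close>

context simple_graph
begin

definition cycle_in :: "'a set \<Rightarrow> 'a list \<Rightarrow> bool" where
  "cycle_in A cs \<longleftrightarrow> distinct cs \<and> 3 \<le> length cs \<and> set cs \<subseteq> A \<and>
    (\<forall>i<length cs. cs ! (Suc i mod length cs) \<in> nbh (cs ! i))"

text \<open>
  All neighbours of the end of a longest path lie on the path; a neighbour other than the next vertex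
  closes a cycle.
\<close>

lemma cycle_in_if_min_degree_two:
  assumes "finite D" "D \<noteq> {}" and deg: "\<And>v. v \<in> D \<Longrightarrow> card (nbh v \<inter> D) \<ge> 2"
  shows "\<exists>cs. cycle_in D cs"
proof -
  define path where "path p \<longleftrightarrow> p \<noteq> [] \<and> distinct p \<and> set p \<subseteq> D \<and>
    (\<forall>i. Suc i < length p \<longrightarrow> p ! Suc i \<in> nbh (p ! i))" for p
  obtain a where "a \<in> D" using assms by blast
  then have ex: "path [a]" by (simp add: path_def)
  have bound: "length p < Suc (card D)" if "path p" for p
    using that card_mono[OF assms(1), of "set p"] distinct_card[of p] by (auto simp: path_def)
  obtain p where p: "path p" and longest: "\<And>q. path q \<Longrightarrow> length q \<le> length p"
    using ex_has_greatest_nat[of path "[a]" length "Suc (card D)"] ex bound by (metis less_imp_le)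
  have p0: "p ! 0 \<in> D" using p by (auto simp: path_def)
  have closed: "nbh (p ! 0) \<inter> D \<subseteq> set p"
  proof
    fix b assume b: "b \<in> nbh (p ! 0) \<inter> D"
    show "b \<in> set p"
    proof (rule ccontr)
      assume "b \<notin> set p"
      then have "path (b # p)"
        using p b nbh_sym by (auto simp: path_def nth_Cons split: nat.split)
      from longest[OF this] show False by simp
    qed
  qed
  have "\<not> nbh (p ! 0) \<inter> D \<subseteq> {p ! 1}"
    using deg[OF p0] card_mono[of "{p ! 1}" "nbh (p ! 0) \<inter> D"] by auto
  then obtain c where c: "c \<in> nbh (p ! 0)" "c \<in> D" "c \<noteq> p ! 1" by blast
  then obtain j where j: "j < length p" "c = p ! j"
    using closed by (metis IntI in_set_conv_nth subsetD)
  have j2: "j \<ge> 2"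
    using c j by (metis One_nat_def less_2_cases not_in_nbh not_le)
  define cs where "cs = take (Suc j) p"
  have len: "length cs = Suc j" using j by (simp add: cs_def)
  have "cs ! (Suc i mod length cs) \<in> nbh (cs ! i)" if i: "i < length cs" for i
  proof (cases "i = j")
    case True
    then show ?thesis using len c j nbh_sym by (simp add: cs_def)
  next
    case False
    then have "Suc i < Suc j" using i len by simp
    then show ?thesis using len p j by (simp add: cs_def path_def)
  qed
  moreover have "distinct cs" "set cs \<subseteq> D" using p set_take_subset unfolding cs_def path_def by fastforce+
  ultimately show ?thesis using len j2 by (auto simp: cycle_in_def)
qed

text \<open>
  The edges at \<open>v\<close> are counted once at \<open>v\<close> and once at their other ends.  Inductive use gives
  both the handshake lemma and the bound on the number of edges of a forest.
\<close>

lemma sum_inner_degree_remove: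
  assumes "finite D" "v \<in> D"
  shows "(\<Sum>w\<in>D. card (nbh w \<inter> D)) =
    2 * card (nbh v \<inter> D) + (\<Sum>w\<in>D - {v}. card (nbh w \<inter> (D - {v})))"
proof -
  have step: "card (nbh w \<inter> D) = card (nbh w \<inter> (D - {v})) + (if w \<in> nbh v then 1 else 0)" for w
  proof (cases "w \<in> nbh v")
    case True
    then have "nbh w \<inter> D = insert v (nbh w \<inter> (D - {v}))" using nbh_sym assms(2) by blast
    then show ?thesis using True by simp
  next
    case False
    then have "nbh w \<inter> D = nbh w \<inter> (D - {v})" using nbh_sym by blast
    then show ?thesis using False by simp
  qed
  have "(\<Sum>w\<in>D - {v}. if w \<in> nbh v then 1 else 0) = card ((D - {v}) \<inter> nbh v)"
    using assms(1) by (simp add: sum.inter_restrict[symmetric])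
  also have "(D - {v}) \<inter> nbh v = nbh v \<inter> D" by auto
  finally have "(\<Sum>w\<in>D - {v}. card (nbh w \<inter> D)) =
      (\<Sum>w\<in>D - {v}. card (nbh w \<inter> (D - {v}))) + card (nbh v \<inter> D)"
    by (subst step) (simp add: sum.distrib)
  then show ?thesis using assms by (simp add: sum.remove)
qed

lemma even_sum_inner_degree:
  assumes "finite D"
  shows "even (\<Sum>w\<in>D. card (nbh w \<inter> D))"
  using assms
proof (induction D)
  case (insert v D)
  then have "insert v D - {v} = D" by auto
  then show ?case using sum_inner_degree_remove[of "insert v D" v] insert by simp
qed simp

text \<open>
  A forest on a nonempty set has fewer edges than vertices, stated for degree sums and without
  subtraction: a vertex of degree at most one can be removed.
\<close>

lemma acyclic_sum_inner_degree_le: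
  assumes "finite D" "D \<noteq> {}" "\<And>cs. \<not> cycle_in D cs"
  shows "(\<Sum>w\<in>D. card (nbh w \<inter> D)) + 2 \<le> 2 * card D"
  using assms
proof (induction "card D" arbitrary: D)
  case 0
  then show ?case by simp
next
  case (Suc k)
  obtain v where v: "v \<in> D" "card (nbh v \<inter> D) \<le> 1"
    using cycle_in_if_min_degree_two[OF Suc.prems(1,2)] Suc.prems(3)
    by (metis Suc_1 not_less_eq_eq)
  show ?case
  proof (cases "D = {v}")
    case True
    then show ?thesis by simp
  next
    case False
    have card: "card (D - {v}) = k" using Suc v by simp
    moreover have "\<not> cycle_in (D - {v}) cs" for cs
      using Suc.prems(3)[of cs] by (auto simp: cycle_in_def)
    ultimately have "(\<Sum>w\<in>D - {v}. card (nbh w \<inter> (D - {v}))) + 2 \<le> 2 * k"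
      using Suc.hyps(1)[of "D - {v}"] Suc.prems False v by auto
    then show ?thesis
      using sum_inner_degree_remove[OF Suc.prems(1) v(1)] v(2) Suc.hyps(2) by linarith
  qed
qed

end

locale acyclic_nbh_graph = simple_graph +
  assumes no_cycle: "\<not> cycle_in (nbh u) cs"

text \<open>
  A cycle in the neighbourhood of \<open>u\<close> together with the hub \<open>u\<close> is a wheel; the map \<open>g\<close> below
  embeds the abstract wheel accordingly.
\<close>

lemma wheel_free_acyclic_nbh:
  assumes G: "pair_graph G" and wf: "wheel_free G"
  shows "acyclic_nbh_graph (pverts G) (parcs G)"
proof -
  interpret simple_graph "pverts G" "parcs G"
    using G by (rule pair_graph_simple_graph)
  show ?thesis
  proof unfold_locales
    fix u cs
    show "\<not> cycle_in (nbh u) cs"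
    proof
      assume cyc: "cycle_in (nbh u) cs"
      define k where "k = length cs"
      have k: "k \<ge> 3" and dist: "distinct cs" and sub: "set cs \<subseteq> nbh u"
        and step: "\<And>i. i < k \<Longrightarrow> cs ! (Suc i mod k) \<in> nbh (cs ! i)"
        using cyc by (auto simp: cycle_in_def k_def)
      have u: "u \<in> pverts G" using sub k nbh_sym nbh_subset
        by (metis k_def last_in_set length_0_conv not_numeral_le_zero subsetD)
      have u_notin: "u \<notin> set cs" using sub not_in_nbh by blast
      define W where "W = wheel_graph (Suc k)"
      have W: "pair_graph W" unfolding W_def using k by (intro pair_graph_wheel_graph) simp
      have Wv: "pverts W = insert (sum_encode (Inl 0)) ((sum_encode \<circ> Inr) ` {..<k})"
        unfolding W_def wheel_graph_def graph_join_def graph_union_def complete_graph_def cycle_graph_def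
        by auto
      have Wa: "parcs W = {(sum_encode (Inr i), sum_encode (Inr j)) | i j. i < k \<and> j < k \<and>
            (j = Suc i mod k \<or> i = Suc j mod k)} \<union>
          {(sum_encode (Inl 0), sum_encode (Inr j)) | j. j < k} \<union>
          {(sum_encode (Inr j), sum_encode (Inl 0)) | j. j < k}"
        unfolding W_def wheel_graph_def graph_join_def graph_union_def complete_graph_def cycle_graph_def
        by auto
      define g where "g a = (case sum_decode a of Inl _ \<Rightarrow> u | Inr i \<Rightarrow> cs ! i)" for a
      have g [simp]: "g (sum_encode (Inl j)) = u" "g (sum_encode (Inr i)) = cs ! i" for i j
        by (simp_all add: g_def)
      define S where "S = \<lparr>pverts = g ` pverts W, parcs = map_prod g g ` parcs W\<rparr>"
      have nth_notin: "cs ! i \<noteq> u" "u \<noteq> cs ! i" if "i < k" for i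
        using u_notin that by (auto simp: k_def)
      have inj: "inj_on g (pverts W)"
        unfolding Wv using dist nth_notin
        by (auto simp: inj_on_def k_def nth_eq_iff_index_eq sum_encode_eq)
      have gV: "g ` pverts W \<subseteq> pverts G"
        unfolding Wv using u sub nbh_subset by (force simp: k_def)
      have gA: "map_prod g g ` parcs W \<subseteq> parcs G"
      proof -
        have "(cs ! i, cs ! (Suc i mod k)) \<in> parcs G" "(cs ! (Suc i mod k), cs ! i) \<in> parcs G"
          "(u, cs ! i) \<in> parcs G" "(cs ! i, u) \<in> parcs G" if "i < k" for i
        proof -
          have "cs ! i \<in> nbh u" using sub that by (auto simp: k_def)
          then show "(u, cs ! i) \<in> parcs G" "(cs ! i, u) \<in> parcs G"
            using nbh_sym by (auto simp: nbh_def)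
          show "(cs ! i, cs ! (Suc i mod k)) \<in> parcs G" "(cs ! (Suc i mod k), cs ! i) \<in> parcs G"
            using step[OF that] nbh_sym by (auto simp: nbh_def)
        qed
        then show ?thesis unfolding Wa by auto
      qed
      have W': "parcs W \<subseteq> pverts W \<times> pverts W" "sym (parcs W)" "irrefl (parcs W)" "finite (pverts W)"
        using W by (auto simp: pair_graph_iff)
      have arcs: "(a, b) \<in> parcs W \<longleftrightarrow> (g a, g b) \<in> parcs S" if "a \<in> pverts W" "b \<in> pverts W" for a b
      proof
        assume "(g a, g b) \<in> parcs S"
        then obtain a' b' where ab: "(a', b') \<in> parcs W" "g a = g a'" "g b = g b'"
          by (auto simp: S_def)
        then have "a = a'" "b = b'" using inj that W'(1) by (auto dest: inj_onD)
        then show "(a, b) \<in> parcs W" using ab by simp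
      qed (force simp: S_def)
      have irr: "irrefl (parcs G)" using G by (simp add: pair_graph_iff)
      have S: "pair_graph S"
        unfolding pair_graph_iff
      proof (intro conjI)
        show "finite (pverts S)" using W'(4) by (simp add: S_def)
        show "parcs S \<subseteq> pverts S \<times> pverts S" using W'(1) by (force simp: S_def)
        show "sym (parcs S)" using W'(2) unfolding S_def sym_def by force
        show "irrefl (parcs S)" using irr gA unfolding S_def irrefl_def by auto
      qed
      interpret W: pair_graph W by (rule W)
      have "digraph_iso (with_proj W) (with_proj S)"
        by (rule digraph_isoI[OF W S _ arcs]) (simp_all add: bij_betw_def inj S_def)
      with W.wf_digraph have iso: "digraph_iso (with_proj S) (with_proj W)"
        by (rule digraph_iso_swap)
      interpret G: pair_graph G by (rule G)
      interpret S: pair_graph S by (rule S)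
      have "subgraph (with_proj S) (with_proj G)"
        unfolding subgraph_def compatible_def
        using gV gA G.wf_digraph S.wf_digraph by (simp add: S_def)
      with iso have "contains_graph G W" unfolding contains_graph_def by blast
      then show False using wf k unfolding wheel_free_def W_def by auto
    qed
  qed
qed

section \<open>Counting walks of length two\<close>

lemma two_elements:
  assumes "\<not> card A \<le> 1"
  obtains a b where "a \<in> A" "b \<in> A" "a \<noteq> b"
proof -
  have "\<not> (\<forall>a\<in>A. \<forall>b\<in>A. a = b)"
    using assms by (metis card_le_Suc0_iff_eq card.infinite One_nat_def le0)
  then show thesis using that by blast
qed

lemma le_if_slack_nonneg:
  fixes a b c d s :: int
  assumes "4 * s = a - b - 4 * c - 4 * d" "0 \<le> b" "0 \<le> c" "0 \<le> d"
  shows "4 * s \<le> a"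
  using assms by linarith

lemma excess_slack_split:
  fixes slack square :: int
  assumes "4 * slack + square \<le> 1" "slack \<ge> 0" "square \<ge> 0"
  shows "slack = 0" "square \<le> 1"
  using assms by auto

context simple_graph
begin

definition deg :: "'a \<Rightarrow> nat" where
  "deg u = card (nbh u)"

text \<open>
  The row sum at \<open>u\<close> of \<open>A\<^sup>2 - A\<close>.  It is an integer because \<open>defect\<close> and the estimates below subtract.
\<close>

definition excess :: "'a \<Rightarrow> int" where
  "excess u = (\<Sum>v\<in>nbh u. int (deg v) - 1)"

text \<open>
  Twice the number of edges inside the neighbourhood.
\<close>

definition inner :: "'a \<Rightarrow> nat" where
  "inner u = (\<Sum>v\<in>nbh u. card (nbh v \<inter> nbh u))"

text \<open>
  The number of non-adjacent pairs between the neighbourhood of \<open>u\<close> and the vertices outside it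
  other than \<open>u\<close>.
\<close>

definition missing :: "'a \<Rightarrow> nat" where
  "missing u = (\<Sum>w\<in>V - nbh u - {u}. card (nbh u - nbh w))"

text \<open>
  The neighbourhood induces a matching.  The vertices that are not of this type have a path on three
  vertices in their neighbourhood and are said to be of path type.
\<close>

definition matching_type :: "'a \<Rightarrow> bool" where
  "matching_type u \<longleftrightarrow> (\<forall>v\<in>nbh u. card (nbh v \<inter> nbh u) \<le> 1)"

lemma double_counting:
  assumes "finite A" "finite B"
  shows "(\<Sum>v\<in>A. card (nbh v \<inter> B)) = (\<Sum>w\<in>B. card (nbh w \<inter> A))"
proof -
  have 1: "card (nbh v \<inter> C) = (\<Sum>w\<in>C. if w \<in> nbh v then 1 else 0)" if "finite C" for v C
    using that by (simp add: sum.inter_restrict[symmetric] Int_commute)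
  show ?thesis
    unfolding 1[OF assms(1)] 1[OF assms(2)] by (subst sum.swap) (simp add: nbh_sym)
qed

lemma deg_less: "u \<in> V \<Longrightarrow> deg u < card V"
  unfolding deg_def using nbh_subset not_in_nbh finite_V
  by (metis psubsetI psubset_card_mono)

lemma card_non_nbh:
  assumes "u \<in> V"
  shows "int (card (V - nbh u - {u})) = int (card V) - int (deg u) - 1"
proof -
  have "card (V - nbh u) = card V - deg u" 
    using nbh_subset by (simp add: card_Diff_subset deg_def)
  moreover have "card (V - nbh u - {u}) = card (V - nbh u) - 1"
    using assms by simp
  ultimately show ?thesis using deg_less[OF assms] by simp
qed

text \<open>
  Every walk \<open>u v w\<close> ends inside or outside the neighbourhood of \<open>u\<close>.  The walks that end inside are
  counted by \<open>inner\<close>, and the others by all pairs except the missing ones.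
\<close>

lemma excess_eq:
  assumes u: "u \<in> V"
  shows "excess u = int (deg u) * (int (card V) - int (deg u)) + int (inner u)
    - int (deg u) - int (missing u)"
proof -
  have split: "deg v = card (nbh v \<inter> nbh u) + card (nbh v \<inter> (V - nbh u))" for v
  proof -
    have "nbh v = (nbh v \<inter> nbh u) \<union> (nbh v \<inter> (V - nbh u))" using nbh_subset by blast
    then show ?thesis unfolding deg_def
      by (metis (no_types, lifting) Diff_disjoint card_Un_disjoint finite_Int finite_nbh
          inf_assoc inf_bot_right inf_left_commute)
  qed
  have out: "int (card (nbh w \<inter> nbh u)) = int (deg u) - int (card (nbh u - nbh w))" for w
    using card_Diff_subset_Int[of "nbh u" "nbh w"] card_mono[of "nbh u" "nbh w \<inter> nbh u"]
    by (simp add: deg_def Int_commute of_nat_diff)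
  have "(\<Sum>v\<in>nbh u. int (card (nbh v \<inter> (V - nbh u)))) =
      (\<Sum>w\<in>V - nbh u. int (card (nbh w \<inter> nbh u)))"
    using double_counting[of "nbh u" "V - nbh u"] finite_V by (simp flip: of_nat_sum)
  also have "\<dots> = int (card (V - nbh u)) * int (deg u) - (\<Sum>w\<in>V - nbh u. int (card (nbh u - nbh w)))"
    by (simp add: out sum_subtractf)
  also have "(\<Sum>w\<in>V - nbh u. int (card (nbh u - nbh w))) = int (missing u)"
    using u finite_V by (subst sum.remove[of _ u]) (auto simp: missing_def)
  also have "int (card (V - nbh u)) = int (card V) - int (deg u)"
    using nbh_subset deg_less[OF u] by (simp add: card_Diff_subset deg_def of_nat_diff)
  finally have "(\<Sum>v\<in>nbh u. int (card (nbh v \<inter> (V - nbh u)))) =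
      (int (card V) - int (deg u)) * int (deg u) - int (missing u)" .
  then show ?thesis
    unfolding excess_def inner_def split sum_subtractf by (simp add: sum.distrib deg_def)
qed

text \<open>
  The excess is \<open>A (A - I) 1\<close>; by symmetry \<open>A\<close> can be moved to the eigenvector twice.
\<close>

lemma sum_mult_excess:
  assumes "nonneg_eigenvector x r"
  shows "(\<Sum>u\<in>V. x u * excess u) = r * (r - 1) * (\<Sum>u\<in>V. x u)"
proof -
  have "(\<Sum>u\<in>V. x u * excess u) = (\<Sum>u\<in>V. x u * adj (\<lambda>v. real (deg v) - 1) u)"
    by (simp add: excess_def adj_def)
  also have "\<dots> = r * (\<Sum>u\<in>V. x u * adj (\<lambda>_. 1) u - x u)"
    unfolding eigenvector_pairing[OF assms] by (simp add: adj_def deg_def algebra_simps)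
  also have "\<dots> = r * (r - 1) * (\<Sum>u\<in>V. x u)"
    unfolding sum_subtractf eigenvector_pairing[OF assms] by (simp add: algebra_simps)
  finally show ?thesis .
qed

lemma matching_type_inner_le: "matching_type u \<Longrightarrow> inner u \<le> deg u"
  unfolding matching_type_def inner_def deg_def
  using sum_mono[of "nbh u" "\<lambda>v. card (nbh v \<inter> nbh u)" "\<lambda>_. 1"] by simp

text \<open>
  Completed squares: besides the square, the subtracted terms are nonnegative in the matching case
  here, and in the path case in the next lemma.
\<close>

lemma matching_type_excess:
  assumes "u \<in> V"
  shows "4 * excess u = (int (card V))\<^sup>2 - (int (card V) - 2 * int (deg u))\<^sup>2
    - 4 * (int (deg u) - int (inner u)) - 4 * int (missing u)"
  unfolding excess_eq[OF assms] by (simp add: power2_eq_square algebra_simps)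

lemma path_type_excess:
  assumes "u \<in> V"
  shows "4 * excess u = (int (card V))\<^sup>2 - (int (card V) + 2 - 2 * int (deg u))\<^sup>2
    - 4 * (2 * int (deg u) - 2 - int (inner u))
    - 4 * (int (missing u) - int (card (V - nbh u - {u})))"
  unfolding excess_eq[OF assms] card_non_nbh[OF assms] by (simp add: power2_eq_square algebra_simps)

end

context acyclic_nbh_graph
begin

lemma no_K4:
  assumes "a \<in> nbh u" "b \<in> nbh u" "c \<in> nbh u" "b \<in> nbh a" "c \<in> nbh b" "c \<in> nbh a"
  shows False
proof -
  have "cycle_in (nbh u) [a, b, c]"
    using assms nbh_sym not_in_nbh
    by (auto simp: cycle_in_def nth_Cons less_Suc_eq split: nat.split)
  then show False using no_cycle by blast
qed

lemma no_C4_in_nbh: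
  assumes "a \<in> nbh u" "b \<in> nbh u" "c \<in> nbh u" "d \<in> nbh u" "a \<noteq> c" "b \<noteq> d"
    and "b \<in> nbh a" "c \<in> nbh b" "d \<in> nbh c" "a \<in> nbh d"
  shows False
proof -
  have "cycle_in (nbh u) [a, b, c, d]"
    using assms not_in_nbh
    by (auto simp: cycle_in_def nth_Cons less_Suc_eq split: nat.split)
  then show False using no_cycle by blast
qed

text \<open>
  The neighbourhood induces a forest.
\<close>

lemma inner_le:
  assumes "nbh u \<noteq> {}"
  shows "inner u + 2 \<le> 2 * deg u"
  unfolding inner_def deg_def
  using acyclic_sum_inner_degree_le[OF finite_nbh assms no_cycle] .

text \<open>
  The \<open>4\<close>-cycle \<open>a u c w\<close> would lie in the neighbourhood of \<open>v\<close>.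
\<close>

lemma not_dominated_twice:
  assumes "w \<noteq> u" "v \<in> nbh u" "v \<in> nbh w" "a \<in> nbh v \<inter> nbh u" "c \<in> nbh v \<inter> nbh u" "a \<noteq> c"
    and "a \<in> nbh w" "c \<in> nbh w"
  shows False
  using assms nbh_sym no_C4_in_nbh[of a v u c w] by blast

lemma path_type_missing:
  assumes "\<not> matching_type u" "w \<noteq> u"
  shows "nbh u - nbh w \<noteq> {}"
proof
  assume sub: "nbh u - nbh w = {}"
  obtain v where v: "v \<in> nbh u" "\<not> card (nbh v \<inter> nbh u) \<le> 1"
    using assms(1) by (auto simp: matching_type_def)
  obtain a c where "a \<in> nbh v \<inter> nbh u" "c \<in> nbh v \<inter> nbh u" "a \<noteq> c"
    using two_elements[OF v(2)] .
  then show False using not_dominated_twice[OF assms(2), of v a c] v(1) sub by blast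
qed

text \<open>
  If \<open>w\<close> misses only \<open>b\<close>, then every path on three vertices in the neighbourhood of \<open>u\<close> passes
  through \<open>b\<close>, since otherwise \<open>w\<close> would dominate it.  So removing \<open>b\<close> leaves a matching.
\<close>

lemma missed_vertex_meets_paths:
  assumes "w \<noteq> u" "nbh u - nbh w = {b}" "v \<in> nbh u" "v \<noteq> b"
  shows "card (nbh v \<inter> (nbh u - {b})) \<le> 1"
proof (rule ccontr)
  assume "\<not> ?thesis"
  then obtain a c where "a \<in> nbh v \<inter> (nbh u - {b})" "c \<in> nbh v \<inter> (nbh u - {b})" "a \<noteq> c"
    using two_elements by blast
  then show False using not_dominated_twice[OF assms(1), of v a c] assms by blast
qed

lemma path_type_missing_ge:
  assumes "\<not> matching_type u"
  shows "card (V - nbh u - {u}) \<le> missing u"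
proof -
  have "(\<Sum>w\<in>V - nbh u - {u}. 1) \<le> missing u"
    unfolding missing_def
  proof (rule sum_mono)
    fix w assume "w \<in> V - nbh u - {u}"
    then have "nbh u - nbh w \<noteq> {}" using path_type_missing[OF assms, of w] by simp
    then show "1 \<le> card (nbh u - nbh w)" by (simp add: Suc_le_eq card_gt_0_iff)
  qed
  then show ?thesis by simp
qed

lemma path_type_nbh_nonempty: "\<not> matching_type u \<Longrightarrow> nbh u \<noteq> {}"
  by (auto simp: matching_type_def)

lemma excess_le:
  assumes u: "u \<in> V"
  shows "4 * excess u \<le> (int (card V))\<^sup>2"
proof (cases "matching_type u")
  case True
  have "0 \<le> int (deg u) - int (inner u)" "0 \<le> int (missing u)"
    using matching_type_inner_le[OF True] by auto
  then show ?thesis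
    by (rule le_if_slack_nonneg[OF matching_type_excess[OF u] zero_le_power2])
next
  case False
  have "0 \<le> 2 * int (deg u) - 2 - int (inner u)"
    using inner_le[OF path_type_nbh_nonempty[OF False]] by auto
  moreover have "0 \<le> int (missing u) - int (card (V - nbh u - {u}))"
    using path_type_missing_ge[OF False] by auto
  ultimately show ?thesis
    by (rule le_if_slack_nonneg[OF path_type_excess[OF u] zero_le_power2])
qed

text \<open>
  The excess is integral, so that an excess of at least \<open>(n\<^sup>2 - 1) / 4\<close> leaves no room for any loss
  apart from the square, which is at most one.  This covers even and odd orders together.
\<close>

lemma matching_type_tight:
  assumes u: "u \<in> V" and m: "matching_type u" and tight: "(int (card V))\<^sup>2 \<le> 4 * excess u + 1"
  shows "(int (card V) - 2 * int (deg u))\<^sup>2 \<le> 1"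
    and "\<And>v. v \<in> nbh u \<Longrightarrow> card (nbh v \<inter> nbh u) = 1"
    and "\<And>w. w \<in> V \<Longrightarrow> w \<notin> nbh u \<Longrightarrow> nbh u \<subseteq> nbh w"
proof -
  have le: "inner u \<le> deg u" using m by (rule matching_type_inner_le)
  have "4 * (int (deg u) - int (inner u) + int (missing u)) +
      (int (card V) - 2 * int (deg u))\<^sup>2 \<le> 1"
    using matching_type_excess[OF u] tight by simp
  from excess_slack_split[OF this] le
  have "inner u = deg u" and miss: "missing u = 0"
    and sq: "(int (card V) - 2 * int (deg u))\<^sup>2 \<le> 1" by auto
  show "(int (card V) - 2 * int (deg u))\<^sup>2 \<le> 1" by (rule sq)
  have "(\<Sum>v\<in>nbh u. 1 - card (nbh v \<inter> nbh u)) = 0"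
    using m \<open>inner u = deg u\<close>
    by (subst sum_subtractf_nat) (auto simp: matching_type_def inner_def deg_def)
  then show "card (nbh v \<inter> nbh u) = 1" if "v \<in> nbh u" for v
    using that m by (force simp: matching_type_def)
  show "nbh u \<subseteq> nbh w" if "w \<in> V" "w \<notin> nbh u" for w
    using that miss finite_V unfolding missing_def by (cases "w = u") auto
qed

lemma path_type_tight:
  assumes u: "u \<in> V" and m: "\<not> matching_type u" and tight: "(int (card V))\<^sup>2 \<le> 4 * excess u + 1"
  shows "(int (card V) + 2 - 2 * int (deg u))\<^sup>2 \<le> 1"
    and "inner u + 2 = 2 * deg u"
    and "\<And>w. w \<in> V - nbh u - {u} \<Longrightarrow> card (nbh u - nbh w) = 1"
proof -
  let ?W = "V - nbh u - {u}"
  have ge: "card ?W \<le> missing u" by (rule path_type_missing_ge[OF m])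
  have le: "inner u + 2 \<le> 2 * deg u" using inner_le[OF path_type_nbh_nonempty[OF m]] .
  have "4 * ((2 * int (deg u) - 2 - int (inner u)) + (int (missing u) - int (card ?W))) +
      (int (card V) + 2 - 2 * int (deg u))\<^sup>2 \<le> 1"
    using path_type_excess[OF u] tight by simp
  from excess_slack_split[OF this] le ge
  have inn: "inner u + 2 = 2 * deg u" and miss: "missing u = card ?W"
    and sq: "(int (card V) + 2 - 2 * int (deg u))\<^sup>2 \<le> 1" by auto
  show "(int (card V) + 2 - 2 * int (deg u))\<^sup>2 \<le> 1" by (rule sq)
  show "inner u + 2 = 2 * deg u" by (rule inn)
  have ge1: "1 \<le> card (nbh u - nbh w)" if "w \<in> ?W" for w
    using path_type_missing[OF m, of w] that by (simp add: Suc_le_eq card_gt_0_iff)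
  then have "(\<Sum>w\<in>?W. card (nbh u - nbh w) - 1) = 0"
    using miss by (subst sum_subtractf_nat) (auto simp: missing_def)
  then have zero: "\<forall>w\<in>?W. card (nbh u - nbh w) - 1 = 0"
    using finite_V by (subst (asm) sum_eq_0_iff) auto
  show "card (nbh u - nbh w) = 1" if "w \<in> ?W" for w
  proof -
    have "card (nbh u - nbh w) - 1 = 0" using zero that by blast
    with ge1[OF that] show ?thesis by linarith
  qed
qed

end

section \<open>Joins of a matching with an independent set\<close>

context simple_graph
begin

definition unmatched :: "'a set \<Rightarrow> 'a set" where
  "unmatched D = {d \<in> D. nbh d \<inter> D = {}}"

text \<open>
  The common shape of all \<open>H\<^sub>n\<close>: a graph \<open>D\<close> of maximum degree at most one, completely joined to an
  independent set \<open>I\<close>.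
\<close>

definition matching_join :: "'a set \<Rightarrow> 'a set \<Rightarrow> bool" where
  "matching_join D I \<longleftrightarrow> D \<union> I = V \<and> D \<inter> I = {} \<and> (\<forall>d\<in>D. I \<subseteq> nbh d) \<and>
    (\<forall>i\<in>I. nbh i \<inter> I = {}) \<and> (\<forall>d\<in>D. card (nbh d \<inter> D) \<le> 1)"

lemma matching_join_nbh:
  assumes "matching_join D I"
  shows "i \<in> I \<Longrightarrow> nbh i = D" "d \<in> D \<Longrightarrow> nbh d = (nbh d \<inter> D) \<union> I"
    "finite D" "finite I" "card V = card D + card I"
proof -
  show fin: "finite D" "finite I"
    using assms finite_V finite_subset[of D V] finite_subset[of I V] by (auto simp: matching_join_def)
  show "nbh i = D" if "i \<in> I"
    using assms that nbh_sym nbh_subset[of i] by (fastforce simp: matching_join_def)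
  show "nbh d = (nbh d \<inter> D) \<union> I" if "d \<in> D"
    using assms that nbh_subset[of d] by (fastforce simp: matching_join_def)
  show "card V = card D + card I"
    using assms fin by (auto simp: matching_join_def card_Un_disjoint)
qed

lemma matching_join_partner_sum:
  assumes "matching_join D I" "d \<in> D"
  shows "nbh d \<inter> D = {} \<longleftrightarrow> d \<in> unmatched D"
    "d \<notin> unmatched D \<Longrightarrow> \<exists>e\<in>D - unmatched D. nbh d \<inter> D = {e}"
proof -
  show 1: "nbh d \<inter> D = {} \<longleftrightarrow> d \<in> unmatched D" using assms(2) by (simp add: unmatched_def)
  assume "d \<notin> unmatched D"
  then have "nbh d \<inter> D \<noteq> {}" "card (nbh d \<inter> D) \<le> 1"
    using 1 assms by (auto simp: matching_join_def)
  then have "card (nbh d \<inter> D) = 1"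
    by (metis One_nat_def card_gt_0_iff finite_Int finite_nbh le_antisym Suc_leI)
  then obtain e where e: "nbh d \<inter> D = {e}" by (auto simp: card_1_singleton_iff)
  then have "d \<in> nbh e \<inter> D" "e \<in> D" using nbh_sym assms(2) by auto
  then have "e \<notin> unmatched D" unfolding unmatched_def by blast
  then show "\<exists>e\<in>D - unmatched D. nbh d \<inter> D = {e}" using e by blast
qed

text \<open>
  The eigenvector is constant on the independent set, on the matched vertices and on the unmatched
  vertices.  The polynomial equation is the eigenvalue condition at the independent set; the other two
  conditions hold identically.
\<close>

lemma matching_join_radius:
  assumes mj: "matching_join D I" and "I \<noteq> {}" and r: "r > 1"
    and poly: "r\<^sup>2 * (r - 1) + real (card (unmatched D)) * real (card I) =
      real (card D) * real (card I) * r"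
    and x: "nonneg_eigenvector x s"
  shows "s = r"
proof -
  note nb = matching_join_nbh[OF mj]
  define q where "q = real (card I)"
  have q: "q > 0" using \<open>I \<noteq> {}\<close> nb(4) by (simp add: q_def card_gt_0_iff)
  define y where "y v = (if v \<in> I then r * (r - 1) else if v \<in> unmatched D then q * (r - 1) else q * r)" for v
  have VDI: "V = D \<union> I" "D \<inter> I = {}" using mj by (auto simp: matching_join_def)
  have U: "unmatched D \<subseteq> D" by (auto simp: unmatched_def)
  show ?thesis
  proof (rule positive_eigenvector_unique[OF x])
    fix v assume v: "v \<in> V"
    show "y v > 0" using r q by (simp add: y_def)
    have yI: "sum y I = q * (r * (r - 1))" by (simp add: y_def q_def)
    show "adj y v = r * y v"
    proof (cases "v \<in> I")
      case True
      have "sum y D = (\<Sum>v\<in>D. q * r - (if v \<in> unmatched D then q else 0))"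
        using VDI by (intro sum.cong) (auto simp: y_def algebra_simps)
      also have "\<dots> = real (card D) * (q * r) - real (card (unmatched D)) * q"
        using nb(3) U by (simp add: sum_subtractf sum.inter_restrict[symmetric] Int_absorb1)
      also have "\<dots> = r * y v" using poly True by (simp add: y_def q_def power2_eq_square algebra_simps)
      finally show ?thesis using nb(1)[OF True] by (simp add: adj_def)
    next
      case False
      then have d: "v \<in> D" using v VDI by blast
      have "adj y v = sum y (nbh v \<inter> D) + sum y I"
        unfolding adj_def by (subst nb(2)[OF d], rule sum.union_disjoint) (use VDI nb in auto)
      moreover have "sum y (nbh v \<inter> D) = (if v \<in> unmatched D then 0 else q * r)"
      proof (cases "v \<in> unmatched D")
        case True
        then show ?thesis using matching_join_partner_sum(1)[OF mj d] by simp
      next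
        case False
        then obtain e where "e \<in> D - unmatched D" "nbh v \<inter> D = {e}"
          using matching_join_partner_sum(2)[OF mj d] by blast
        then show ?thesis using False VDI by (auto simp: y_def)
      qed
      ultimately show ?thesis using False yI by (auto simp: y_def algebra_simps)
    qed
  qed
qed

end

text \<open>
  A matching is determined up to isomorphism by its numbers of vertices and of unmatched vertices:
  edges are removed from both sides until none is left.
\<close>

lemma partial_matching_iso:
  assumes "finite D" "finite D'" "card D = card D'"
    and "sym R" "sym R'" "irrefl R" "irrefl R'"
    and "\<And>a b c. a \<in> D \<Longrightarrow> b \<in> D \<Longrightarrow> c \<in> D \<Longrightarrow> (a, b) \<in> R \<Longrightarrow> (a, c) \<in> R \<Longrightarrow> b = c"
    and "\<And>a b c. a \<in> D' \<Longrightarrow> b \<in> D' \<Longrightarrow> c \<in> D' \<Longrightarrow> (a, b) \<in> R' \<Longrightarrow> (a, c) \<in> R' \<Longrightarrow> b = c"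
    and "card {a \<in> D. \<forall>b\<in>D. (a, b) \<notin> R} = card {a \<in> D'. \<forall>b\<in>D'. (a, b) \<notin> R'}"
  shows "\<exists>f. bij_betw f D D' \<and> (\<forall>a\<in>D. \<forall>b\<in>D. (a, b) \<in> R \<longleftrightarrow> (f a, f b) \<in> R')"
  using assms(1-3,8-10)
proof (induction "card D" arbitrary: D D' rule: less_induct)
  case less
  let ?U = "\<lambda>D R. {a \<in> D. \<forall>b\<in>D. (a, b) \<notin> R}"
  have sub: "?U D R \<subseteq> D" "?U D' R' \<subseteq> D'" by auto
  show ?case
  proof (cases "?U D R = D")
    case True
    have "card (?U D' R') = card D'" using less.prems(3,6) by (simp only: True)
    then have "?U D' R' = D'" by (rule card_subset_eq[OF less.prems(2) sub(2)])
    then have D': "(a, b) \<notin> R'" if "a \<in> D'" "b \<in> D'" for a b using that by blast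
    have D: "(a, b) \<notin> R" if "a \<in> D" "b \<in> D" for a b using True that by blast
    obtain f where "bij_betw f D D'"
      using finite_same_card_bij less.prems(1-3) by blast
    moreover from this have "f a \<in> D'" if "a \<in> D" for a using that by (rule bij_betw_apply)
    ultimately show ?thesis using D D' by blast
  next
    case False
    then obtain a b where ab: "a \<in> D" "b \<in> D" "(a, b) \<in> R" by blast
    have "?U D' R' \<noteq> D'"
    proof
      assume "?U D' R' = D'"
      then have "card (?U D R) = card D" using less.prems(3,6) by simp
      with False show False using card_subset_eq[OF less.prems(1) sub(1)] by blast
    qed
    then obtain a' b' where ab': "a' \<in> D'" "b' \<in> D'" "(a', b') \<in> R'" by blast
    have ne: "a \<noteq> b" "a' \<noteq> b'" using ab ab' assms(6,7) by (auto simp: irrefl_def)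
    have ba: "(b, a) \<in> R" "(b', a') \<in> R'" using ab ab' assms(4,5) by (auto dest: symD)
    define C where "C = D - {a, b}"
    define C' where "C' = D' - {a', b'}"
    have C: "finite C" "C \<subseteq> D" "D = insert a (insert b C)" "a \<notin> C" "b \<notin> C"
      and C': "finite C'" "C' \<subseteq> D'" "D' = insert a' (insert b' C')" "a' \<notin> C'" "b' \<notin> C'"
      using ab ab' less.prems by (auto simp: C_def C'_def)
    have sep: "(c, a) \<notin> R" "(c, b) \<notin> R" "(a, c) \<notin> R" "(b, c) \<notin> R" if "c \<in> C" for c
      using that less.prems(4)[of a b c] less.prems(4)[of b a c] ab ba C assms(4)
      by (auto dest: symD)
    have sep': "(c, a') \<notin> R'" "(c, b') \<notin> R'" "(a', c) \<notin> R'" "(b', c) \<notin> R'" if "c \<in> C'" for c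
      using that less.prems(5)[of a' b' c] less.prems(5)[of b' a' c] ab' ba C' assms(5)
      by (auto dest: symD)
    have U: "?U C R = ?U D R" "?U C' R' = ?U D' R'"
      unfolding C(3) C'(3) using sep sep' ab(3) ab'(3) ba by auto
    have "card D = Suc (Suc (card C))"
      by (subst C(3)) (use C(1,4,5) ne in simp)
    moreover have "card D' = Suc (Suc (card C'))"
      by (subst C'(3)) (use C'(1,4,5) ne in simp)
    ultimately have cards: "card C < card D" "card C = card C'"
      using less.prems(3) by simp_all
    have "\<exists>f. bij_betw f C C' \<and> (\<forall>x\<in>C. \<forall>y\<in>C. (x, y) \<in> R \<longleftrightarrow> (f x, f y) \<in> R')"
    proof (rule less.hyps[OF cards(1) C(1) C'(1) cards(2)])
      show "b = c" if "a \<in> C" "b \<in> C" "c \<in> C" "(a, b) \<in> R" "(a, c) \<in> R" for a b c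
        using less.prems(4) that C(2) by blast
      show "b = c" if "a \<in> C'" "b \<in> C'" "c \<in> C'" "(a, b) \<in> R'" "(a, c) \<in> R'" for a b c
        using less.prems(5) that C'(2) by blast
      show "card (?U C R) = card (?U C' R')" unfolding U by (rule less.prems(6))
    qed
    then obtain f where f: "bij_betw f C C'"
      "\<And>x y. x \<in> C \<Longrightarrow> y \<in> C \<Longrightarrow> (x, y) \<in> R \<longleftrightarrow> (f x, f y) \<in> R'"
      by blast
    define g where "g = f(a := a', b := b')"
    have g: "g a = a'" "g b = b'" "\<And>c. c \<in> C \<Longrightarrow> g c = f c" using ne C by (auto simp: g_def)
    have "bij_betw g C C'" using f(1) g(3) by (simp cong: bij_betw_cong)
    moreover have "bij_betw g {a, b} {a', b'}" using ne g by (auto simp: bij_betw_def)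
    ultimately have "bij_betw g ({a, b} \<union> C) ({a', b'} \<union> C')"
      using C'(4,5) by (intro bij_betw_combine) auto
    then have "bij_betw g D D'" using C(3) C'(3) by simp
    moreover have "(x, y) \<in> R \<longleftrightarrow> (g x, g y) \<in> R'" if "x \<in> D" "y \<in> D" for x y
    proof -
      have "f c \<in> C'" if "c \<in> C" for c using f(1) that by (auto dest: bij_betwE)
      then show ?thesis
        using that f(2) sep sep' ab ab' ba assms(6,7) unfolding C(3)
        by (auto simp: g irrefl_def)
    qed
    ultimately show ?thesis by blast
  qed
qed

lemma matching_join_iso:
  assumes G: "pair_graph G" and H: "pair_graph H"
    and mj: "simple_graph.matching_join (pverts G) (parcs G) D I"
      "simple_graph.matching_join (pverts H) (parcs H) D' I'"
    and card: "card D = card D'" "card I = card I'"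
      "card (simple_graph.unmatched (parcs G) D) = card (simple_graph.unmatched (parcs H) D')"
  shows "digraph_iso (with_proj G) (with_proj H)"
proof -
  interpret G: simple_graph "pverts G" "parcs G" using G by (rule pair_graph_simple_graph)
  interpret H: simple_graph "pverts H" "parcs H" using H by (rule pair_graph_simple_graph)
  note nbG = G.matching_join_nbh[OF mj(1)] and nbH = H.matching_join_nbh[OF mj(2)]
  have uniqG: "b = c" if "a \<in> D" "b \<in> D" "c \<in> D" "(a, b) \<in> parcs G" "(a, c) \<in> parcs G" for a b c
    using mj(1) that card_le_Suc0_iff_eq[of "G.nbh a \<inter> D"] nbG(3)
    unfolding G.matching_join_def by (auto simp: G.nbh_def)
  have uniqH: "b = c" if "a \<in> D'" "b \<in> D'" "c \<in> D'" "(a, b) \<in> parcs H" "(a, c) \<in> parcs H" for a b c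
    using mj(2) that card_le_Suc0_iff_eq[of "H.nbh a \<inter> D'"] nbH(3)
    unfolding H.matching_join_def by (auto simp: H.nbh_def)
  have UG: "G.unmatched D = {a \<in> D. \<forall>b\<in>D. (a, b) \<notin> parcs G}"
    and UH: "H.unmatched D' = {a \<in> D'. \<forall>b\<in>D'. (a, b) \<notin> parcs H}"
    by (auto simp: G.unmatched_def H.unmatched_def G.nbh_def H.nbh_def)
  have "\<exists>f. bij_betw f D D' \<and> (\<forall>a\<in>D. \<forall>b\<in>D. (a, b) \<in> parcs G \<longleftrightarrow> (f a, f b) \<in> parcs H)"
  proof (rule partial_matching_iso[OF nbG(3) nbH(3) card(1) G.sym_E H.sym_E G.irrefl_E H.irrefl_E])
    show "b = c" if "a \<in> D" "b \<in> D" "c \<in> D" "(a, b) \<in> parcs G" "(a, c) \<in> parcs G" for a b c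
      using that by (rule uniqG)
    show "b = c" if "a \<in> D'" "b \<in> D'" "c \<in> D'" "(a, b) \<in> parcs H" "(a, c) \<in> parcs H" for a b c
      using that by (rule uniqH)
    show "card {a \<in> D. \<forall>b\<in>D. (a, b) \<notin> parcs G} = card {a \<in> D'. \<forall>b\<in>D'. (a, b) \<notin> parcs H}"
      using card(3) unfolding UG UH .
  qed
  then obtain f where f: "bij_betw f D D'"
    and fR: "\<And>a b. a \<in> D \<Longrightarrow> b \<in> D \<Longrightarrow> (a, b) \<in> parcs G \<longleftrightarrow> (f a, f b) \<in> parcs H"
    by blast
  obtain g where g: "bij_betw g I I'" using finite_same_card_bij nbG(4) nbH(4) card(2) by blast
  define h where "h v = (if v \<in> D then f v else g v)" for v
  have D: "pverts G = D \<union> I" "D \<inter> I = {}" "pverts H = D' \<union> I'" "D' \<inter> I' = {}"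
    using mj by (auto simp: G.matching_join_def H.matching_join_def)
  have hD: "h d = f d" "f d \<in> D'" if "d \<in> D" for d using that f by (auto simp: h_def dest: bij_betwE)
  have hI: "h i = g i" "g i \<in> I'" if "i \<in> I" for i using that g D by (auto simp: h_def dest: bij_betwE)
  have "bij_betw h D D'" "bij_betw h I I'" using f g hD hI by (simp_all cong: bij_betw_cong)
  then have "bij_betw h (pverts G) (pverts H)"
    unfolding D(1,3) using D(4) by (rule bij_betw_combine)
  moreover have "(u, v) \<in> parcs G \<longleftrightarrow> (h u, h v) \<in> parcs H" if "u \<in> pverts G" "v \<in> pverts G" for u v
  proof -
    have "G.nbh i = D" "H.nbh (g i) = D'" if "i \<in> I" for i using that nbG(1) nbH(1) hI by auto
    then have 1: "(i, v) \<in> parcs G \<longleftrightarrow> v \<in> D" "(g i, w) \<in> parcs H \<longleftrightarrow> w \<in> D'" if "i \<in> I" for i v w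
      using that unfolding G.nbh_def H.nbh_def by auto
    have 2: "(d, i) \<in> parcs G" "(f d, g i) \<in> parcs H" if "d \<in> D" "i \<in> I" for d i
    proof -
      have "(i, d) \<in> parcs G" "(g i, f d) \<in> parcs H" using 1[OF that(2)] that(1) hD(2) by auto
      then show "(d, i) \<in> parcs G" "(f d, g i) \<in> parcs H"
        using G.sym_E H.sym_E by (auto dest: symD)
    qed
    show ?thesis
    proof (cases "u \<in> D")
      case u: True
      show ?thesis using u that D(1,2) fR hD hI 2 by (cases "v \<in> D") auto
    next
      case False
      then have "u \<in> I" using that D by auto
      then show ?thesis using that D hD hI 1[OF \<open>u \<in> I\<close>] by (cases "v \<in> D") auto
    qed
  qed
  ultimately show ?thesis by (intro digraph_isoI[OF G H]) auto
qed

section \<open>The graphs \<open>H\<^sub>n\<close>\<close>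

text \<open>
  The number of vertices of \<open>H\<^sub>n\<close> on the side that carries the matching, in one formula for all
  residues of \<open>n\<close> modulo \<open>4\<close>.
\<close>

definition matching_size :: "nat \<Rightarrow> nat" where
  "matching_size n = 2 * ((n + 1) div 4) + (if n mod 4 = 2 then 1 else 0)"

lemma graph_join_matching_join:
  assumes A: "pair_graph A" and B: "pair_graph B" and "parcs B = {}"
    and uniq: "\<forall>a b c. (a, b) \<in> parcs A \<longrightarrow> (a, c) \<in> parcs A \<longrightarrow> b = c"
  defines "J \<equiv> graph_join A B"
  defines "D \<equiv> (sum_encode \<circ> Inl) ` pverts A" and "I \<equiv> (sum_encode \<circ> Inr) ` pverts B"
  shows "simple_graph.matching_join (pverts J) (parcs J) D I"
    and "card D = card (pverts A)" "card I = card (pverts B)"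
    and "card (simple_graph.unmatched (parcs J) D) =
      card {a \<in> pverts A. \<forall>b\<in>pverts A. (a, b) \<notin> parcs A}"
proof -
  interpret simple_graph "pverts J" "parcs J"
    unfolding J_def by (intro pair_graph_simple_graph pair_graph_graph_join A B)
  have V: "pverts J = D \<union> I"
    unfolding J_def D_def I_def graph_join_def graph_union_def by (auto simp: image_image)
  have A': "parcs A \<subseteq> pverts A \<times> pverts A" using A by (simp add: pair_graph_iff)
  have E: "parcs J = {(sum_encode (Inl a), sum_encode (Inl b)) | a b. (a, b) \<in> parcs A} \<union>
       {(sum_encode (Inl u), sum_encode (Inr v)) |u v. u \<in> pverts A \<and> v \<in> pverts B} \<union>
       {(sum_encode (Inr v), sum_encode (Inl u)) |u v. u \<in> pverts A \<and> v \<in> pverts B}"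
    unfolding J_def graph_join_def graph_union_def using assms(3) by auto
  have nbE: "v \<in> nbh u \<longleftrightarrow>
      (\<exists>a b. u = sum_encode (Inl a) \<and> v = sum_encode (Inl b) \<and> (a, b) \<in> parcs A) \<or>
      (\<exists>a b. u = sum_encode (Inl a) \<and> v = sum_encode (Inr b) \<and> a \<in> pverts A \<and> b \<in> pverts B) \<or>
      (\<exists>a b. u = sum_encode (Inr b) \<and> v = sum_encode (Inl a) \<and> a \<in> pverts A \<and> b \<in> pverts B)" for u v
    unfolding nbh_def mem_Collect_eq by (subst E) auto
  have inj: "inj (sum_encode \<circ> Inl)" "inj (sum_encode \<circ> Inr)"
    by (auto simp: inj_def sum_encode_eq)
  show "card D = card (pverts A)" "card I = card (pverts B)"
    by (simp_all only: D_def I_def card_image[OF inj_on_subset[OF inj(1) subset_UNIV]]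
        card_image[OF inj_on_subset[OF inj(2) subset_UNIV]])
  have nbD: "nbh (sum_encode (Inl a)) \<inter> D = (sum_encode \<circ> Inl) ` {b. (a, b) \<in> parcs A}" for a
    using A' unfolding D_def by (auto simp: nbE sum_encode_eq)
  have "card (nbh d \<inter> D) \<le> 1" if d: "d \<in> D" for d
  proof -
    obtain a where a: "d = sum_encode (Inl a)" using d by (auto simp: D_def)
    have "\<forall>b\<in>nbh d \<inter> D. \<forall>c\<in>nbh d \<inter> D. b = c"
      unfolding a nbD using uniq by auto
    then show ?thesis by (simp add: card_le_Suc0_iff_eq)
  qed
  moreover have "D \<inter> I = {}" by (auto simp: D_def I_def sum_encode_eq)
  moreover have "I \<subseteq> nbh d" if "d \<in> D" for d
    using that by (auto simp: D_def I_def nbE sum_encode_eq)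
  moreover have "nbh i \<inter> I = {}" if "i \<in> I" for i
    using that by (auto simp: D_def I_def nbE sum_encode_eq)
  ultimately show "matching_join D I"
    unfolding matching_join_def using V by blast
  have "unmatched D = (sum_encode \<circ> Inl) ` {a \<in> pverts A. \<forall>b\<in>pverts A. (a, b) \<notin> parcs A}"
  proof -
    have "nbh (sum_encode (Inl a)) \<inter> D = {} \<longleftrightarrow> (\<forall>b\<in>pverts A. (a, b) \<notin> parcs A)" for a
      unfolding nbD using A' by auto
    moreover have "d \<in> D \<longleftrightarrow> (\<exists>a\<in>pverts A. d = sum_encode (Inl a))" for d
      by (auto simp: D_def)
    ultimately show ?thesis by (auto simp: unmatched_def)
  qed
  then show "card (unmatched D) = card {a \<in> pverts A. \<forall>b\<in>pverts A. (a, b) \<notin> parcs A}"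
    by (simp only: card_image[OF inj_on_subset[OF inj(1) subset_UNIV]])
qed

lemma graph_copies_K1_arcs: "parcs (graph_copies k (complete_graph 1)) = {}"
  by (auto simp: graph_copies_def complete_graph_def)

lemma graph_copies_K2:
  fixes k :: nat
  defines "M \<equiv> graph_copies k (complete_graph 2)"
  shows "\<forall>a b c. (a, b) \<in> parcs M \<longrightarrow> (a, c) \<in> parcs M \<longrightarrow> b = c"
    and "a \<in> pverts M \<Longrightarrow> \<exists>b\<in>pverts M. (a, b) \<in> parcs M"
proof -
  show "\<forall>a b c. (a, b) \<in> parcs M \<longrightarrow> (a, c) \<in> parcs M \<longrightarrow> b = c"
    by (auto simp: M_def graph_copies_def complete_graph_def prod_encode_eq)
next
  assume "a \<in> pverts M"
  then obtain i u where a: "a = prod_encode (i, u)" "i < k" "u < 2"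
    by (auto simp: M_def graph_copies_def complete_graph_def)
  have "u \<noteq> 1 - u" "1 - u < 2" using a(3) by arith+
  with a show "\<exists>b\<in>pverts M. (a, b) \<in> parcs M"
    by (intro bexI[of _ "prod_encode (i, 1 - u)"])
      (auto simp: M_def graph_copies_def complete_graph_def prod_encode_eq)
qed

lemma H_graph_matching_join:
  obtains D I where "simple_graph.matching_join (pverts (H_graph n)) (parcs (H_graph n)) D I"
    and "card D = matching_size n" "card I = n - matching_size n"
    and "card (simple_graph.unmatched (parcs (H_graph n)) D) = (if n mod 4 = 2 then 1 else 0)"
proof -
  have pg: "pair_graph (graph_copies k (complete_graph l))" for k l
    by (intro pair_graph_graph_copies pair_graph_complete_graph)
  note witness = that
  have K2: thesis if H: "H_graph n = graph_join (graph_copies k (complete_graph 2)) (graph_copies l (complete_graph 1))"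
    and sizes: "2 * k = matching_size n" "n mod 4 \<noteq> 2" "2 * k + l = n" for k l
  proof -
    let ?M = "graph_copies k (complete_graph 2)"
    have U: "{a \<in> pverts ?M. \<forall>b\<in>pverts ?M. (a, b) \<notin> parcs ?M} = {}"
      using graph_copies_K2(2) by blast
    note J = graph_join_matching_join[OF pg[of k 2] pg[of l 1] graph_copies_K1_arcs
        graph_copies_K2(1), folded H, unfolded U]
    show thesis
      by (rule witness[OF J(1)], unfold J(2-4))
        (use sizes in \<open>simp_all add: card_graph_copies card_complete_graph\<close>)
  qed
  define q where "q = n div 4"
  have "n mod 4 < 4" by simp
  then have "n mod 4 = 0 \<or> n mod 4 = 1 \<or> n mod 4 = 2 \<or> n mod 4 = 3"
    by linarith
  then consider "n = 4 * q" | "n = 4 * q + 1" | "n = 4 * q + 2" | "n = 4 * q + 3"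
    using div_mult_mod_eq[of n 4] unfolding q_def by linarith
  then show thesis
  proof cases
    case 1
    then have "n mod 4 = 0" "n div 4 = q" "n div 2 = 2 * q" "(n + 1) div 4 = q" by simp_all
    with 1 show ?thesis by (intro K2[of q "2 * q"]) (simp_all add: H_graph_def matching_size_def)
  next
    case 2
    then have "n mod 4 = 1" "(n - 1) div 4 = q" "(n + 1) div 2 = 2 * q + 1" "(n + 1) div 4 = q"
      by simp_all
    with 2 show ?thesis by (intro K2[of q "2 * q + 1"]) (simp_all add: H_graph_def matching_size_def)
  next
    case 4
    then have "n mod 4 = 3" "(n + 1) div 4 = q + 1" "(n - 1) div 2 = 2 * q + 1" by simp_all
    with 4 show ?thesis by (intro K2[of "q + 1" "2 * q + 1"]) (simp_all add: H_graph_def matching_size_def)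
  next
    case 3
    then have "n mod 4 = 2" by presburger
    moreover from 3 have "(n - 2) div 4 = q" "n div 2 = 2 * q + 1" "(n + 1) div 4 = q" by simp_all
    ultimately have m: "matching_size n = 2 * q + 1" "n mod 4 = 2"
      and H: "H_graph n = graph_join (graph_union (graph_copies q (complete_graph 2)) (complete_graph 1))
        (graph_copies (2 * q + 1) (complete_graph 1))"
      by (simp_all add: matching_size_def H_graph_def)
    have m': "n - Suc (2 * q) = Suc (2 * q)" using 3 by simp
    let ?M = "graph_copies q (complete_graph 2)"
    let ?A = "graph_union ?M (complete_graph 1)"
    have A: "pair_graph ?A" by (intro pair_graph_graph_union pg pair_graph_complete_graph)
    have Aa: "parcs ?A = {(sum_encode (Inl a), sum_encode (Inl b)) | a b. (a, b) \<in> parcs ?M}"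
      and Av: "pverts ?A = insert (sum_encode (Inr 0)) ((sum_encode \<circ> Inl) ` pverts ?M)"
      unfolding graph_union_def by (auto simp: complete_graph_def)
    have uniq: "\<forall>a b c. (a, b) \<in> parcs ?A \<longrightarrow> (a, c) \<in> parcs ?A \<longrightarrow> b = c"
      using graph_copies_K2(1)[of q] unfolding Aa by (auto simp: sum_encode_eq)
    have U: "{a \<in> pverts ?A. \<forall>b\<in>pverts ?A. (a, b) \<notin> parcs ?A} = {sum_encode (Inr 0)}"
      using graph_copies_K2(2) unfolding Aa Av by (fastforce simp: sum_encode_eq)
    have "card (pverts ?A) = 2 * q + 1"
      using pg[of q 2] by (subst card_graph_union)
        (auto simp: card_graph_copies card_complete_graph pair_graph_iff complete_graph_def)
    moreover note J = graph_join_matching_join[OF A pg[of "2 * q + 1" 1] graph_copies_K1_arcs uniq,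
        folded H, unfolded U]
    ultimately show ?thesis
      by - (rule witness[OF J(1)], unfold J(2-4),
        simp_all add: m m' card_graph_copies card_complete_graph)
  qed
qed

section \<open>Vertices of maximal excess\<close>

lemma near_multiple_of_four:
  fixes n e :: nat
  assumes "n + 1 = 4 * e \<or> n = 4 * e \<or> n = 4 * e + 1"
  shows "n mod 4 \<noteq> 2 \<and> (n + 1) div 4 = e"
  using assms by (elim disjE) (presburger | simp)+

context acyclic_nbh_graph
begin

text \<open>
  In the tight matching case every vertex outside the neighbourhood \<open>D\<close> of \<open>u\<close> is adjacent to all
  of \<open>D\<close>.  As \<open>D\<close> contains an edge, two adjacent vertices outside would complete it to a \<open>K\<^sub>4\<close>.
  Parity of \<open>d\<close> then leaves only one value of \<open>d\<close> near \<open>n / 2\<close>, and none if \<open>n\<close> is congruent to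
  \<open>2\<close> modulo \<open>4\<close>.
\<close>

lemma matching_type_tight_join:
  assumes u: "u \<in> V" and m: "matching_type u" and tight: "(int (card V))\<^sup>2 \<le> 4 * excess u + 1"
    and "nbh u \<noteq> {}"
  shows "matching_join (nbh u) (V - nbh u)" "unmatched (nbh u) = {}"
    and "card (nbh u) = matching_size (card V)" "card V mod 4 \<noteq> 2"
proof -
  note t = matching_type_tight[OF u m tight]
  have "nbh i \<inter> (V - nbh u) = {}" if i: "i \<in> V - nbh u" for i
  proof (rule ccontr)
    assume "\<not> ?thesis"
    then obtain j where j: "j \<in> nbh i" "j \<in> V - nbh u" by blast
    obtain a where a: "a \<in> nbh u" using \<open>nbh u \<noteq> {}\<close> by blast
    obtain b where b: "b \<in> nbh a" "b \<in> nbh u"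
      using t(2)[OF a] by (auto simp: card_1_singleton_iff)
    have "nbh u \<subseteq> nbh i" "nbh u \<subseteq> nbh j" using t(3) i j by auto
    then show False using no_K4[of i a j b] a b j nbh_sym by blast
  qed
  then show "matching_join (nbh u) (V - nbh u)"
    using nbh_subset t(2,3) nbh_sym by (fastforce simp: matching_join_def)
  show "unmatched (nbh u) = {}" using t(2) by (fastforce simp: unmatched_def)
  have "even (deg u)"
    using even_sum_inner_degree[OF finite_nbh, of u] t(2) by (simp add: deg_def)
  then obtain e where e: "deg u = 2 * e" by blast
  have "\<bar>int (card V) - 4 * int e\<bar> \<le> 1"
    using t(1) e by (simp add: abs_square_le_1)
  then have "card V + 1 = 4 * e \<or> card V = 4 * e \<or> card V = 4 * e + 1" by linarith
  then have "card V mod 4 \<noteq> 2 \<and> (card V + 1) div 4 = e" by (rule near_multiple_of_four)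
  then show "card (nbh u) = matching_size (card V)" "card V mod 4 \<noteq> 2"
    using e by (auto simp: matching_size_def deg_def)
qed

text \<open>
  The forest \<open>N(u)\<close> has \<open>d - 1\<close> edges.  Those that avoid \<open>b\<close> form a matching on the \<open>d - 1\<close> other
  vertices, so at least half of all edges are at \<open>b\<close>.
\<close>

lemma missed_vertex_degree:
  assumes inn: "inner u + 2 = 2 * deg u" and w: "w \<noteq> u" "nbh u - nbh w = {b}"
  shows "2 * card (nbh b \<inter> nbh u) + (\<Sum>m\<in>nbh u - {b}. card (nbh m \<inter> (nbh u - {b}))) + 2 = 2 * deg u"
    and "(\<Sum>m\<in>nbh u - {b}. card (nbh m \<inter> (nbh u - {b}))) + 1 \<le> deg u"
proof -
  have b: "b \<in> nbh u" using w(2) by blast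
  show 1: "2 * card (nbh b \<inter> nbh u) + (\<Sum>m\<in>nbh u - {b}. card (nbh m \<inter> (nbh u - {b}))) + 2 = 2 * deg u"
    using sum_inner_degree_remove[OF finite_nbh b] inn by (simp add: inner_def)
  have "(\<Sum>m\<in>nbh u - {b}. card (nbh m \<inter> (nbh u - {b}))) \<le> (\<Sum>m\<in>nbh u - {b}. 1)"
    using missed_vertex_meets_paths[OF w] by (intro sum_mono) auto
  also have "\<dots> = deg u - 1" using b by (simp add: deg_def)
  finally show "(\<Sum>m\<in>nbh u - {b}. card (nbh m \<inter> (nbh u - {b}))) + 1 \<le> deg u"
    using b by (metis Suc_eq_plus1 Suc_le_mono Suc_pred' card_gt_0_iff deg_def empty_iff finite_nbh)
qed

text \<open>
  At least three neighbours of \<open>b\<close> in \<open>N(u)\<close> leave a path with middle \<open>b\<close> that avoids any given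
  second vertex \<open>b'\<close>.
\<close>

lemma missed_vertex_unique:
  assumes inn: "inner u + 2 = 2 * deg u" and "deg u \<ge> 6"
    and w: "w \<noteq> u" "nbh u - nbh w = {b}" and w': "w' \<noteq> u" "nbh u - nbh w' = {b'}"
  shows "b' = b"
proof (rule ccontr)
  assume "b' \<noteq> b"
  have "card (nbh b \<inter> nbh u) \<ge> 3"
    using missed_vertex_degree[OF inn w] \<open>deg u \<ge> 6\<close> by linarith
  moreover have "card (nbh b \<inter> nbh u) - 1 \<le> card (nbh b \<inter> nbh u - {b'})"
    using diff_card_le_card_Diff[of "{b'}" "nbh b \<inter> nbh u"] by simp
  moreover have "nbh b \<inter> nbh u - {b'} = nbh b \<inter> (nbh u - {b'})" by blast
  moreover have "card (nbh b \<inter> (nbh u - {b'})) \<le> 1"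
    using missed_vertex_meets_paths[OF w', of b] w(2) \<open>b' \<noteq> b\<close> by blast
  ultimately show False by simp
qed

end

text \<open>
  The neighbourhood of \<open>u\<close> is a tree, and all vertices of the remaining set \<open>W\<close> miss the same
  vertex \<open>b\<close> of it.  The rest \<open>M\<close> of the neighbourhood is then completely joined to \<open>u\<close> and \<open>W\<close>, and
  what is left open are the edges inside \<open>M\<close>, inside \<open>W\<close>, and between \<open>b\<close> and \<open>M\<close>.
\<close>

locale missed_vertex = acyclic_nbh_graph +
  fixes u b :: 'a
  assumes u: "u \<in> V"
    and inner_tight: "inner u + 2 = 2 * deg u"
    and others_nonempty: "V - nbh u - {u} \<noteq> {}"
    and missed: "w \<in> V - nbh u - {u} \<Longrightarrow> nbh u - nbh w = {b}"
begin

definition M :: "'a set" where "M = nbh u - {b}"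
definition W :: "'a set" where "W = V - nbh u - {u}"

lemma b_mem: "b \<in> nbh u" "b \<in> V" "b \<notin> M"
proof -
  obtain w where "w \<in> V - nbh u - {u}" using others_nonempty by blast
  then show "b \<in> nbh u" using missed by blast
  then show "b \<in> V" using nbh_subset by blast
qed (simp add: M_def)

lemma M_basic: "finite M" "M \<subseteq> V" "u \<notin> M" "nbh u = insert b M" "deg u = card M + 1"
proof -
  show fin: "finite M" "M \<subseteq> V" "u \<notin> M" using nbh_subset by (auto simp: M_def)
  show ins: "nbh u = insert b M" using b_mem by (auto simp: M_def)
  show "deg u = card M + 1" unfolding deg_def ins using fin(1) b_mem(3) by simp
qed

lemma W_basic: "finite W" "W \<subseteq> V" "u \<notin> W" "b \<notin> W" "M \<inter> W = {}" "w \<in> W \<Longrightarrow> M \<subseteq> nbh w"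
  "w \<in> W \<Longrightarrow> b \<notin> nbh w" "V = insert u (insert b (M \<union> W))"
  using finite_V b_mem missed[of w] u nbh_subset[of u] by (auto simp: W_def M_def)

lemma M_degree_le: "m \<in> M \<Longrightarrow> card (nbh m \<inter> M) \<le> 1"
proof -
  assume m: "m \<in> M"
  obtain w where "w \<in> V - nbh u - {u}" using others_nonempty by blast
  then show ?thesis
    using missed_vertex_meets_paths[of w u b m] missed m by (auto simp: M_def)
qed

text \<open>
  Each edge inside \<open>M\<close> is compensated by a vertex of \<open>M\<close> that is not adjacent to \<open>b\<close>.
\<close>

lemma b_degree: "2 * card (nbh b \<inter> M) + (\<Sum>m\<in>M. card (nbh m \<inter> M)) = 2 * card M"
proof -
  obtain w where w: "w \<in> V - nbh u - {u}" using others_nonempty by blast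
  have "nbh b \<inter> nbh u = nbh b \<inter> M" by (auto simp: M_def)
  then show ?thesis
    using missed_vertex_degree(1)[OF inner_tight, of w b] missed[OF w] w M_basic(5)
    by (simp add: M_def[symmetric])
qed

lemma nbh_b_M: "nbh b = insert u (nbh b \<inter> M)"
proof -
  have "v \<in> insert u M" if "v \<in> nbh b" for v
  proof -
    have "v \<in> V" "v \<noteq> b" using that nbh_subset by auto
    moreover have "v \<notin> W" using W_basic(7)[of v] that nbh_sym by blast
    ultimately show ?thesis using W_basic(8) by blast
  qed
  moreover have "u \<in> nbh b" using b_mem(1) nbh_sym by blast
  ultimately show ?thesis by blast
qed

text \<open>
  If \<open>M\<close> carries no edge, then \<open>b\<close> takes part in the complete join as well.
\<close>

lemma star_case:
  assumes "(\<Sum>m\<in>M. card (nbh m \<inter> M)) = 0"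
  shows "m \<in> M \<Longrightarrow> nbh m \<inter> M = {}" "v \<in> V - M \<Longrightarrow> M \<subseteq> nbh v"
proof -
  show "nbh m \<inter> M = {}" if "m \<in> M" using that assms M_basic(1) by simp
  have "card (nbh b \<inter> M) = card M" using b_degree assms by simp
  then have "nbh b \<inter> M = M" using card_subset_eq[OF M_basic(1), of "nbh b \<inter> M"] by simp
  then have "M \<subseteq> nbh b" by blast
  moreover have "v = u \<or> v = b \<or> v \<in> W" if "v \<in> V - M" for v using that W_basic(8) by blast
  ultimately show "M \<subseteq> nbh v" if "v \<in> V - M"
    using that W_basic(6)[of v] M_basic(4) by blast
qed

text \<open>
  Regularity forces \<open>b\<close>, whose only neighbour outside \<open>M\<close> is \<open>u\<close>, to be adjacent to all of \<open>M\<close>.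
  Then \<open>M\<close> is independent, the neighbourhood of a vertex of \<open>M\<close> is the complement of \<open>M\<close>, and
  each vertex there has one neighbour left for it.
\<close>

lemma regular_has_matching_type:
  assumes card: "card V = 2 * h + 1" and reg: "\<And>v. v \<in> V \<Longrightarrow> deg v = h + 1" and "h \<ge> 1"
  shows "\<exists>m\<in>V. matching_type m"
proof -
  have cM: "card M = h" using M_basic(5) reg[OF u] by simp
  have "deg b = Suc (card (nbh b \<inter> M))"
    unfolding deg_def by (subst nbh_b_M) (use M_basic(1,3) in simp)
  then have "card (nbh b \<inter> M) = h" using reg[OF b_mem(2)] by simp
  then have "(\<Sum>m\<in>M. card (nbh m \<inter> M)) = 0" using b_degree cM by simp
  note star = star_case[OF this]
  have "M \<noteq> {}" using cM \<open>h \<ge> 1\<close> by auto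
  then obtain m where m: "m \<in> M" by blast
  then have mV: "m \<in> V" using M_basic(2) by blast
  have "nbh m \<subseteq> V - M" using star(1)[OF m] nbh_subset by blast
  moreover have "card (V - M) = card (nbh m)"
    using reg[OF mV] M_basic(1,2) card cM by (simp add: card_Diff_subset deg_def)
  ultimately have nm: "nbh m = V - M" using finite_V by (metis card_subset_eq finite_Diff)
  have "card (nbh v \<inter> nbh m) \<le> 1" if v: "v \<in> nbh m" for v
  proof -
    have "nbh v \<inter> nbh m = nbh v - M" using nm nbh_subset by blast
    moreover have "card (nbh v - M) = deg v - card M"
      using star(2) v nm M_basic(1) by (simp add: card_Diff_subset deg_def)
    moreover have "deg v = h + 1" using reg v nbh_subset by blast
    ultimately show ?thesis using cM by simp
  qed
  then show ?thesis using mV by (auto simp: matching_type_def)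
qed

end

context acyclic_nbh_graph
begin

text \<open>
  A vertex and its two neighbours on the cycle leave four vertices, which by regularity are all
  adjacent to it.
\<close>

lemma regular_complement_cycle:
  assumes cs: "distinct cs" "set cs = V" "length cs = 7"
    and reg: "\<And>v. v \<in> V \<Longrightarrow> deg v = 4"
    and non: "\<And>i. i < 7 \<Longrightarrow> cs ! ((i + 1) mod 7) \<notin> nbh (cs ! i)"
    and ij: "i < 7" "j < 7"
  shows "cs ! j \<in> nbh (cs ! i) \<longleftrightarrow> j \<noteq> i \<and> j \<noteq> (i + 1) mod 7 \<and> i \<noteq> (j + 1) mod 7"
proof -
  define p where "p = (i + 6) mod 7"
  have i7: "i = 0 \<or> i = 1 \<or> i = 2 \<or> i = 3 \<or> i = 4 \<or> i = 5 \<or> i = 6"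
    and j7: "j = 0 \<or> j = 1 \<or> j = 2 \<or> j = 3 \<or> j = 4 \<or> j = 5 \<or> j = 6"
    using ij by auto
  have p: "p < 7" "(p + 1) mod 7 = i" unfolding p_def using i7 by (elim disjE; simp)+
  have jp: "i = (j + 1) mod 7 \<longleftrightarrow> j = p" unfolding p_def using i7 j7 by (elim disjE; simp)
  define B where "B = {i, (i + 1) mod 7, p}"
  have "card B = 3" unfolding B_def p_def using i7 by (elim disjE; simp)
  moreover have B: "B \<subseteq> {..<7}" using ij p by (auto simp: B_def)
  have inj: "inj_on ((!) cs) {..<7}" using cs by (simp add: inj_on_nth)
  ultimately have "card ((!) cs ` B) = 3" using inj_on_subset[OF inj B] by (simp add: card_image)
  moreover have sub: "(!) cs ` B \<subseteq> V" using B cs by auto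
  moreover have "card V = 7" using cs distinct_card by metis
  ultimately have "card (V - (!) cs ` B) = 4"
    using finite_V by (simp add: card_Diff_subset finite_subset)
  moreover have iV: "cs ! i \<in> V" using ij cs by auto
  moreover have "nbh (cs ! i) \<subseteq> V - (!) cs ` B"
    using nbh_subset non[OF ij(1)] non[OF p(1)] p(2) nbh_sym by (auto simp: B_def)
  ultimately have "nbh (cs ! i) = V - (!) cs ` B"
    using reg[OF iV] finite_V by (intro card_subset_eq) (auto simp: deg_def)
  moreover have "cs ! j \<in> (!) cs ` B \<longleftrightarrow> j \<in> B"
    using inj B ij by (auto simp: inj_on_def)
  moreover have "cs ! j \<in> V" using ij cs by auto
  ultimately show ?thesis unfolding jp by (auto simp: B_def)
qed

text \<open>
  If all vertices are tight of path type, then the degrees are \<open>n / 2 + 1\<close> for even \<open>n\<close>, and \<open>(n + 1) / 2\<close>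
  or \<open>(n + 3) / 2\<close> for odd \<open>n\<close>.  As the excess is a sum of degrees, this makes it too large except for
  odd \<open>n\<close> and the smaller degree throughout; the handshake lemma settles the parity of \<open>h\<close>.
\<close>

lemma all_path_type_regular:
  assumes path: "\<And>u. u \<in> V \<Longrightarrow> \<not> matching_type u" and "V \<noteq> {}"
    and tight: "\<And>u. u \<in> V \<Longrightarrow> 4 * excess u = (int (card V))\<^sup>2 - int (card V mod 2)"
  obtains h where "odd h" "card V = 2 * h + 1" "\<And>v. v \<in> V \<Longrightarrow> deg v = h + 1"
proof -
  have tight': "(int (card V))\<^sup>2 \<le> 4 * excess u + 1" if "u \<in> V" for u
    using tight[OF that] by simp
  have sq: "\<bar>int (card V) + 2 - 2 * int (deg u)\<bar> \<le> 1" if "u \<in> V" for u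
    using path_type_tight(1)[OF that path[OF that] tight'[OF that]] by (simp add: abs_square_le_1)
  obtain u0 where u0: "u0 \<in> V" using \<open>V \<noteq> {}\<close> by blast
  have nV: "v \<in> V" if "v \<in> nbh u" for u v using that nbh_subset by blast
  show thesis
  proof (cases "even (card V)")
    case True
    then obtain h where h: "card V = 2 * h" by blast
    have d: "deg u = h + 1" if "u \<in> V" for u using sq[OF that] h by linarith
    have "excess u0 = (\<Sum>v\<in>nbh u0. int h)"
      unfolding excess_def using d nV by (intro sum.cong) auto
    then have "excess u0 = int (h + 1) * int h" using d[OF u0] by (simp add: deg_def)
    then have "h = 0" using tight[OF u0] h by (simp add: power2_eq_square algebra_simps)
    then show thesis using h \<open>V \<noteq> {}\<close> finite_V by simp
  next
    case False
    then obtain h where h: "card V = 2 * h + 1" using oddE by blast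
    have ge: "h + 1 \<le> deg u" "deg u \<le> h + 2" if "u \<in> V" for u using sq[OF that] h by linarith+
    have ex: "excess u = int h * int (h + 1)" if "u \<in> V" for u
    proof -
      have "card V mod 2 = 1" using h by presburger
      then have "4 * excess u = 4 * (int h * int (h + 1))"
        using tight[OF that] h by (simp add: power2_eq_square algebra_simps)
      then show ?thesis by simp
    qed
    have reg: "deg u = h + 1" if u: "u \<in> V" for u
    proof (rule ccontr)
      assume "deg u \<noteq> h + 1"
      then have du: "deg u = h + 2" using ge[OF u] by simp
      have "(\<Sum>v\<in>nbh u. int h) \<le> excess u"
        unfolding excess_def using ge nV by (intro sum_mono) force
      then have "int (h + 2) * int h \<le> int h * int (h + 1)"
        using du ex[OF u] by (simp add: deg_def)
      then have "h = 0" by (simp add: algebra_simps)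
      then show False using du deg_less[OF u] h by simp
    qed
    have "even (\<Sum>w\<in>V. card (nbh w \<inter> V))" by (rule even_sum_inner_degree[OF finite_V])
    moreover have "(\<Sum>w\<in>V. card (nbh w \<inter> V)) = (\<Sum>w\<in>V. h + 1)"
    proof (rule sum.cong)
      fix w assume "w \<in> V"
      then show "card (nbh w \<inter> V) = h + 1"
        using reg nbh_subset by (simp add: deg_def Int_absorb2)
    qed simp
    ultimately have "even ((2 * h + 1) * (h + 1))" using h by simp
    then have "odd h" by simp
    then show thesis using that h reg by blast
  qed
qed

text \<open>
  If all non-neighbours of \<open>u\<close> missed the same vertex, some vertex would be of matching type.  They
  miss the same vertex as soon as \<open>d \<ge> 6\<close>, so \<open>n = 7\<close> and \<open>d = 4\<close>, and the two non-neighbours \<open>w1\<close> and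
  \<open>w2\<close> miss different vertices \<open>b1\<close> and \<open>b2\<close>.  Both have to be inner vertices of the tree on the
  four neighbours, which is the path \<open>a b1 b2 d\<close>; the complement is now forced.
\<close>

lemma all_path_type_complement_C7:
  assumes path: "\<And>u. u \<in> V \<Longrightarrow> \<not> matching_type u" and "card V \<ge> 4"
    and tight: "\<And>u. u \<in> V \<Longrightarrow> 4 * excess u = (int (card V))\<^sup>2 - int (card V mod 2)"
  obtains cs where "distinct cs" "set cs = V" "length cs = 7"
    and "\<And>i j. i < 7 \<Longrightarrow> j < 7 \<Longrightarrow>
      cs ! j \<in> nbh (cs ! i) \<longleftrightarrow> j \<noteq> i \<and> j \<noteq> (i + 1) mod 7 \<and> i \<noteq> (j + 1) mod 7"
proof -
  have ne: "V \<noteq> {}" using \<open>card V \<ge> 4\<close> by auto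
  obtain h where h: "odd h" "card V = 2 * h + 1" and reg: "\<And>v. v \<in> V \<Longrightarrow> deg v = h + 1"
    using all_path_type_regular[OF path ne tight] by blast
  have h3: "h \<ge> 3" using h \<open>card V \<ge> 4\<close> by (cases "h = 1 \<or> h = 2") auto
  obtain u where u: "u \<in> V" using ne by blast
  have tight': "(int (card V))\<^sup>2 \<le> 4 * excess u + 1" using tight[OF u] by simp
  note t = path_type_tight[OF u path[OF u] tight']
  define W where "W = V - nbh u - {u}"
  have cW: "card W = h - 1" using card_non_nbh[OF u] h reg[OF u] by (simp add: W_def)
  then have "\<not> card W \<le> 1" using h3 by simp
  then obtain w1 w2 where w: "w1 \<in> W" "w2 \<in> W" "w1 \<noteq> w2" by (rule two_elements)
  have miss: "\<exists>b. nbh u - nbh w = {b}" if "w \<in> W" for w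
    using t(3) that by (auto simp: W_def card_1_singleton_iff)
  have no_common: False if "\<And>w. w \<in> W \<Longrightarrow> nbh u - nbh w = {b}" for b
  proof -
    interpret missed_vertex V E u b
      using u t(2) w(1) that by unfold_locales (auto simp: W_def)
    show False using regular_has_matching_type[OF h(2) reg] h3 path by auto
  qed
  have Wu: "w \<noteq> u" "w \<in> V" "w \<notin> nbh u" if "w \<in> W" for w using that by (auto simp: W_def)
  obtain b1 where b1: "nbh u - nbh w1 = {b1}" using miss w by blast
  have h_eq: "h = 3"
  proof (rule ccontr)
    assume "h \<noteq> 3"
    then have "deg u \<ge> 6" using h3 h(1) reg[OF u] by (cases "h = 4") auto
    then have "nbh u - nbh w = {b1}" if "w \<in> W" for w
      using miss[OF that] missed_vertex_unique[OF t(2) _ Wu(1)[OF w(1)] b1 Wu(1)[OF that]] by blast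
    then show False by (rule no_common)
  qed
  have W: "W = {w1, w2}"
  proof -
    have "{w1, w2} \<subseteq> W" "card {w1, w2} = card W" "finite W"
      using w cW h_eq finite_V by (auto simp: W_def)
    then show ?thesis by (metis card_subset_eq)
  qed
  obtain b2 where b2: "nbh u - nbh w2 = {b2}" using miss w by blast
  have b12: "b1 \<noteq> b2" using no_common[of b1] b1 b2 W by blast
  have bs: "b1 \<in> nbh u" "b2 \<in> nbh u" using b1 b2 by blast+
  have du: "deg u = 4" using reg[OF u] h_eq by simp
  have nbrs: "\<exists>x. x \<noteq> c \<and> x \<in> nbh u \<and> nbh b \<inter> nbh u = {c, x}"
    if "w \<in> W" "nbh u - nbh w = {b}" "w' \<in> W" "nbh u - nbh w' = {c}" "b \<noteq> c" for w w' b c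
  proof -
    have ge: "card (nbh b \<inter> nbh u) \<ge> 2"
      using missed_vertex_degree[OF t(2) Wu(1)[OF that(1)] that(2)] du by linarith
    have "card (nbh b \<inter> (nbh u - {c})) \<le> 1"
      using missed_vertex_meets_paths[OF Wu(1)[OF that(3)] that(4), of b] that by blast
    moreover have "nbh b \<inter> (nbh u - {c}) = nbh b \<inter> nbh u - {c}" by blast
    ultimately have le: "card (nbh b \<inter> nbh u - {c}) \<le> 1" by (simp only:)
    have "c \<in> nbh b \<inter> nbh u"
    proof (rule ccontr)
      assume "c \<notin> nbh b \<inter> nbh u"
      then have "nbh b \<inter> nbh u - {c} = nbh b \<inter> nbh u" by blast
      then show False using ge le by (simp only:)
    qed
    moreover from this have "card (nbh b \<inter> nbh u - {c}) = card (nbh b \<inter> nbh u) - 1"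
      by (rule card_Diff_singleton)
    with ge le have "card (nbh b \<inter> nbh u - {c}) = 1" by linarith
    then obtain x where "nbh b \<inter> nbh u - {c} = {x}" by (elim card_1_singletonE)
    ultimately show ?thesis by blast
  qed
  obtain a where a: "a \<noteq> b2" "a \<in> nbh u" "nbh b1 \<inter> nbh u = {b2, a}"
    using nbrs[OF w(1) b1 w(2) b2 b12] by blast
  obtain d where d: "d \<noteq> b1" "d \<in> nbh u" "nbh b2 \<inter> nbh u = {b1, d}"
    using nbrs[OF w(2) b2 w(1) b1 b12[symmetric]] by blast
  have ab: "a \<noteq> b1" "d \<noteq> b2" using a d not_in_nbh by blast+
  have adj: "a \<in> nbh b1" "d \<in> nbh b2" "b2 \<in> nbh b1" using a d by auto
  have ad: "a \<noteq> d"
  proof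
    assume "a = d"
    then show False using no_K4[of b1 u b2 a] bs a adj by blast
  qed
  have T: "nbh u = {a, b1, b2, d}"
  proof -
    have "{a, b1, b2, d} \<subseteq> nbh u" using a d bs by blast
    moreover have "card {a, b1, b2, d} = card (nbh u)"
      using a(1) d(1) ab ad b12 du by (simp add: deg_def)
    ultimately show ?thesis by (metis card_subset_eq finite_nbh)
  qed
  have "a \<notin> nbh d"
  proof
    assume "a \<in> nbh d"
    then have "{a, b2} \<subseteq> nbh d \<inter> (nbh u - {b1})" using adj nbh_sym a bs ab b12 by blast
    then have "card {a, b2} \<le> card (nbh d \<inter> (nbh u - {b1}))" by (intro card_mono) auto
    then show False
      using missed_vertex_meets_paths[OF Wu(1)[OF w(1)] b1 d(2,1)] a(1) by simp
  qed
  \<comment> \<open>Consecutive vertices are non-adjacent: this is the \<open>7\<close>-cycle of the complement.\<close>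
  define cs where "cs = [u, w1, b1, d, a, b2, w2]"
  have V: "V = {u, w1, b1, d, a, b2, w2}"
  proof -
    have "V = insert u (nbh u \<union> W)" using u nbh_subset by (auto simp: W_def)
    then show ?thesis unfolding T W by auto
  qed
  have non: "cs ! ((i + 1) mod 7) \<notin> nbh (cs ! i)" if "i < 7" for i
  proof -
    have "w1 \<notin> nbh u" "w2 \<notin> nbh u" using Wu w by auto
    moreover have "b1 \<notin> nbh w1" "b2 \<notin> nbh w2" using b1 b2 by auto
    moreover have "d \<notin> nbh b1" using a(3) d(2) ad ab(2) by auto
    moreover have "a \<notin> nbh b2" using d(3) a(2) ad ab(1) by auto
    moreover note \<open>a \<notin> nbh d\<close>
    ultimately have "w1 \<notin> nbh u" "b1 \<notin> nbh w1" "d \<notin> nbh b1" "a \<notin> nbh d" "b2 \<notin> nbh a"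
      "w2 \<notin> nbh b2" "u \<notin> nbh w2"
      using nbh_sym[of a b2] nbh_sym[of b2 w2] nbh_sym[of u w2] by simp_all
    moreover have "i = 0 \<or> i = 1 \<or> i = 2 \<or> i = 3 \<or> i = 4 \<or> i = 5 \<or> i = 6" using that by auto
    ultimately show ?thesis by (auto simp: cs_def)
  qed
  have len: "length cs = 7" "set cs = V" by (auto simp: cs_def V)
  moreover have "distinct cs" using len h_eq h(2) by (simp add: card_distinct)
  moreover have "deg v = 4" if "v \<in> V" for v using reg[OF that] h_eq by simp
  ultimately show thesis
    using that regular_complement_cycle[of cs] non by blast
qed

end

section \<open>Orders congruent to two modulo four\<close>

text \<open>
  The factor of the characteristic polynomial of \<open>H\<^sub>n\<close> that belongs to eigenvectors constant on the
  three kinds of vertices, for \<open>n = 2 h\<close> with \<open>h\<close> odd.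
\<close>

definition cubic :: "nat \<Rightarrow> real \<Rightarrow> real" where
  "cubic h r = r ^ 3 - r\<^sup>2 - (real h)\<^sup>2 * r + real h"

context simple_graph
begin

text \<open>
  Only graphs of even order \<open>2 h\<close> are considered, where the division is exact.
\<close>

definition defect :: "'a \<Rightarrow> int" where
  "defect u = (int (card V div 2))\<^sup>2 - excess u"

lemma sum_mult_defect:
  assumes x: "nonneg_eigenvector x r" and card: "card V = 2 * h"
  shows "(\<Sum>v\<in>V. x v * real_of_int (defect v)) = ((real h)\<^sup>2 - r\<^sup>2 + r) * sum x V"
proof -
  have "x v * real_of_int (defect v) = (real h)\<^sup>2 * x v - x v * excess v" for v
    using card by (simp add: defect_def algebra_simps)
  then have "(\<Sum>v\<in>V. x v * real_of_int (defect v)) =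
      (real h)\<^sup>2 * sum x V - (\<Sum>v\<in>V. x v * excess v)"
    by (simp add: sum_subtractf sum_distrib_left)
  then show ?thesis
    unfolding sum_mult_excess[OF x] by (simp add: algebra_simps power2_eq_square)
qed

text \<open>
  The polynomial \<open>cubic h\<close> is \<open>h - t (h\<^sup>2 - t\<^sup>2 + t)\<close>, and \<open>h\<^sup>2 - A\<^sup>2 + A\<close> has the defects as row sums.
\<close>

lemma sum_mult_adj_defect:
  assumes x: "nonneg_eigenvector x r" and card: "card V = 2 * h"
  shows "(\<Sum>v\<in>V. x v * (real h - real_of_int (adj defect v))) = cubic h r * sum x V"
proof -
  have "real_of_int (adj defect v) = adj (\<lambda>v. real_of_int (defect v)) v" for v
    by (simp add: adj_def)
  then have "(\<Sum>v\<in>V. x v * (real h - real_of_int (adj defect v))) =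
      real h * sum x V - r * (\<Sum>v\<in>V. x v * real_of_int (defect v))"
    using eigenvector_pairing[OF x, of "\<lambda>v. real_of_int (defect v)"]
    by (simp add: right_diff_distrib sum_subtractf sum_distrib_left mult.commute)
  then show ?thesis
    unfolding sum_mult_defect[OF assms]
    by (simp add: cubic_def algebra_simps power2_eq_square power3_eq_cube)
qed

lemma eigenvector_sum_pos:
  assumes "nonneg_eigenvector x r"
  shows "sum x V > 0"
  using eigenvector_weight_pos[OF assms, of "\<lambda>_. 1"] by simp

lemma cubic_neg_if_adj_defect:
  assumes x: "nonneg_eigenvector x r" and card: "card V = 2 * h"
    and ge: "\<And>v. v \<in> V \<Longrightarrow> adj defect v \<ge> int h"
    and gt: "a \<in> V" "x a > 0" "adj defect a > int h"
  shows "cubic h r < 0"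
proof -
  have le: "x v * (real h - real_of_int (adj defect v)) \<le> 0" if "v \<in> V" for v
  proof -
    have "real h \<le> real_of_int (adj defect v)" using ge[OF that] by linarith
    moreover have "x v \<ge> 0" using x that by (auto simp: nonneg_eigenvector_def)
    ultimately show ?thesis by (simp add: mult_nonneg_nonpos)
  qed
  have "real h < real_of_int (adj defect a)" using gt(3) by linarith
  then have "x a * (real h - real_of_int (adj defect a)) < 0"
    using gt(2) by (simp add: mult_pos_neg)
  then have "(\<Sum>v\<in>V. x v * (real h - real_of_int (adj defect v))) < (\<Sum>v\<in>V. 0)"
    using le gt(1) finite_V by (intro sum_strict_mono_ex1) auto
  then show ?thesis
    unfolding sum_mult_adj_defect[OF x card] using eigenvector_sum_pos[OF x]
    by (simp add: mult_less_0_iff)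
qed

lemma cubic_neg_if_defect_pos:
  assumes x: "nonneg_eigenvector x r" and card: "card V = 2 * h" and "r > real h"
    and ge: "\<And>v. v \<in> V \<Longrightarrow> defect v \<ge> 1"
  shows "cubic h r < 0"
proof -
  have "sum x V \<le> (\<Sum>v\<in>V. x v * real_of_int (defect v))"
  proof (rule sum_mono)
    fix v assume v: "v \<in> V"
    have "x v \<ge> 0" "real_of_int (defect v) \<ge> 1" 
      using x v ge[OF v] by (auto simp: nonneg_eigenvector_def)
    then show "x v \<le> x v * real_of_int (defect v)"
      using mult_left_mono[of 1 "real_of_int (defect v)" "x v"] by simp
  qed
  then have "1 * sum x V \<le> ((real h)\<^sup>2 - r\<^sup>2 + r) * sum x V"
    unfolding sum_mult_defect[OF x card] by simp
  then have "1 \<le> (real h)\<^sup>2 - r\<^sup>2 + r"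
    using eigenvector_sum_pos[OF x] by (rule mult_right_le_imp_le)
  then have "r * 1 \<le> r * ((real h)\<^sup>2 - r\<^sup>2 + r)"
    using \<open>r > real h\<close> by (intro mult_left_mono) auto
  then show ?thesis
    using \<open>r > real h\<close> by (simp add: cubic_def algebra_simps power2_eq_square power3_eq_cube)
qed

text \<open>
  The independent vertices have the number of unmatched vertices as their defect, and the unmatched
  vertices have defect \<open>h\<close>.  With exactly one unmatched vertex all sums of defects over neighbourhoods
  are \<open>h\<close>, as in \<open>H\<^sub>n\<close>; with more of them they are larger.
\<close>

lemma matching_join_cubic_neg:
  assumes mj: "matching_join D I" and card: "card D = h" "card I = h" and h: "h \<ge> 1"
    and U: "card (unmatched D) \<ge> 2" and x: "nonneg_eigenvector x r"
  shows "cubic h r < 0"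
proof -
  note nb = matching_join_nbh[OF mj]
  have VDI: "V = D \<union> I" "D \<inter> I = {}" using mj by (auto simp: matching_join_def)
  have cV: "card V = 2 * h" using nb(5) card by simp
  let ?U = "unmatched D"
  have degI: "deg i = h" if "i \<in> I" for i using nb(1)[OF that] card by (simp add: deg_def)
  have degD: "int (deg d) = int h + 1 - (if d \<in> ?U then 1 else 0)" if d: "d \<in> D" for d
  proof -
    have "card (nbh d) = card (nbh d \<inter> D) + card I"
      by (subst nb(2)[OF d], rule card_Un_disjoint) (use VDI nb in auto)
    moreover have "card (nbh d \<inter> D) = (if d \<in> ?U then 0 else 1)"
      using matching_join_partner_sum[OF mj d] by auto
    ultimately show ?thesis using card by (simp add: deg_def)
  qed
  have UD: "?U \<subseteq> D" by (auto simp: unmatched_def)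
  have sumU: "(\<Sum>d\<in>D. if d \<in> ?U then 1 else 0) = int (card ?U)"
    using nb(3) UD by (simp add: sum.inter_restrict[symmetric] Int_absorb1)
  have defI: "defect i = int (card ?U)" if "i \<in> I" for i
  proof -
    have "excess i = (\<Sum>d\<in>D. int h - (if d \<in> ?U then 1 else 0))"
      unfolding excess_def nb(1)[OF that] by (intro sum.cong) (auto simp: degD)
    also have "\<dots> = int h * int h - int (card ?U)"
      using card sumU by (simp add: sum_subtractf)
    finally show ?thesis using cV by (simp add: defect_def power2_eq_square)
  qed
  have defU: "defect d = int h" if d: "d \<in> ?U" for d
  proof -
    have "nbh d = I" using matching_join_partner_sum(1)[OF mj, of d] nb(2)[of d] d UD by blast
    then have "excess d = int h * (int h - 1)"
      unfolding excess_def using degI card by simp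
    then show ?thesis using cV by (simp add: defect_def power2_eq_square algebra_simps)
  qed
  have def_nonneg: "defect d \<ge> 0" if d: "d \<in> D" for d
  proof (cases "d \<in> ?U")
    case True then show ?thesis using defU by simp
  next
    case False
    obtain e where e: "e \<in> D - ?U" "nbh d \<inter> D = {e}"
      using matching_join_partner_sum(2)[OF mj d False] by blast
    have "excess d = (\<Sum>v\<in>insert e I. int (deg v) - 1)"
      unfolding excess_def by (subst nb(2)[OF d]) (simp add: e(2))
    also have "\<dots> = int (deg e) - 1 + int h * (int h - 1)"
      using e(1) VDI nb(4) degI card by (subst sum.insert) auto
    also have "\<dots> = int h * int h" using degD[of e] e(1) by (simp add: algebra_simps)
    finally show ?thesis using cV by (simp add: defect_def power2_eq_square)
  qed
  have ge2: "2 * int h \<le> adj defect v" if v: "v \<in> V" for v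
  proof (cases "v \<in> I")
    case True
    have "2 * int h \<le> int (card ?U) * int h" using U by (intro mult_right_mono) auto
    also have "\<dots> = (\<Sum>d\<in>?U. defect d)" using defU by simp
    also have "\<dots> \<le> (\<Sum>d\<in>D. defect d)" using def_nonneg UD nb(3) by (intro sum_mono2) auto
    finally show ?thesis using nb(1)[OF True] by (simp add: adj_def)
  next
    case False
    then have d: "v \<in> D" using v VDI by blast
    have "2 * int h \<le> int (card ?U) * int h" using U by (intro mult_right_mono) auto
    also have "\<dots> = (\<Sum>i\<in>I. defect i)" using defI card by simp
    also have "\<dots> \<le> (\<Sum>i\<in>nbh v. defect i)"
      using def_nonneg nb(2)[OF d] by (intro sum_mono2) auto
    finally show ?thesis by (simp add: adj_def)
  qed
  obtain a where a: "a \<in> V" "x a > 0" using x by (auto simp: nonneg_eigenvector_def)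
  show ?thesis
  proof (rule cubic_neg_if_adj_defect[OF x cV _ a])
    show "int h \<le> adj defect v" if "v \<in> V" for v using ge2[OF that] by simp
    show "int h < adj defect a" using ge2[OF a(1)] h by simp
  qed
qed

end

lemma (in acyclic_nbh_graph) defect_nonneg:
  assumes "card V = 2 * h" "v \<in> V"
  shows "defect v \<ge> 0"
  using excess_le[OF assms(2)] assms(1) by (simp add: defect_def power2_eq_square)

text \<open>
  The situation around a vertex \<open>u\<close> of defect \<open>0\<close> in a graph of order \<open>2 h\<close>.
\<close>

locale half_missed_vertex = missed_vertex +
  fixes h :: nat
  assumes card_V: "card V = 2 * h" and card_M: "card M = h" and odd_h: "odd h" and h_ge: "h \<ge> 3"
begin

lemma card_W: "card W = h - 2"
proof -
  have "int (card W) = int (card V) - int (deg u) - 1" using card_non_nbh[OF u] by (simp add: W_def)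
  then show ?thesis using card_V card_M M_basic(5) h_ge by simp
qed

text \<open>
  The complement of \<open>M\<close> induces a matching: a vertex with two neighbours there would see a \<open>4\<close>-cycle
  through two vertices of \<open>M\<close>.  As \<open>h\<close> is odd, some vertex is unmatched.
\<close>

lemma star_case_structure:
  assumes zero: "(\<Sum>m\<in>M. card (nbh m \<inter> M)) = 0" and x: "nonneg_eigenvector x r"
  shows "(\<exists>D I. matching_join D I \<and> card D = h \<and> card I = h \<and> card (unmatched D) = 1) \<or>
    cubic h r < 0"
proof -
  note star = star_case[OF zero]
  define D where "D = V - M"
  have cD: "card D = h"
    using M_basic(1,2) card_V card_M by (simp add: D_def card_Diff_subset)
  have fD: "finite D" using finite_V by (simp add: D_def)
  have "\<not> card M \<le> 1" using card_M h_ge by simp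
  then obtain m1 m2 where m: "m1 \<in> M" "m2 \<in> M" "m1 \<noteq> m2" by (rule two_elements)
  have deg1: "card (nbh v \<inter> D) \<le> 1" if v: "v \<in> D" for v
  proof (rule ccontr)
    assume "\<not> ?thesis"
    then obtain p q where pq: "p \<in> nbh v \<inter> D" "q \<in> nbh v \<inter> D" "p \<noteq> q" by (rule two_elements)
    have full: "M \<subseteq> nbh v" "M \<subseteq> nbh p" "M \<subseteq> nbh q" using star(2) v pq by (auto simp: D_def)
    have "m1 \<in> nbh v" "m2 \<in> nbh v" "m1 \<in> nbh p" "m2 \<in> nbh q" using full m by auto
    moreover have "q \<in> nbh m1" "p \<in> nbh m2" using full m nbh_sym by auto
    ultimately show False using no_C4_in_nbh[of p v m1 q m2] pq m(3) by blast
  qed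
  have mj: "matching_join D M"
    unfolding matching_join_def using star deg1 M_basic(2) by (auto simp: D_def)
  have "card (unmatched D) \<noteq> 0"
  proof
    assume "card (unmatched D) = 0"
    moreover have "finite (unmatched D)" using fD by (simp add: unmatched_def)
    ultimately have "unmatched D = {}" by simp
    then have "card (nbh d \<inter> D) = 1" if "d \<in> D" for d
      using matching_join_partner_sum(2)[OF mj that] by auto
    then have "(\<Sum>d\<in>D. card (nbh d \<inter> D)) = h" using cD by simp
    then show False using even_sum_inner_degree[OF fD] odd_h by simp
  qed
  then consider "card (unmatched D) = 1" | "card (unmatched D) \<ge> 2" by linarith
  then show ?thesis
  proof cases
    case 1
    then show ?thesis using mj cD card_M by blast
  next
    case 2
    then show ?thesis using matching_join_cubic_neg[OF mj cD card_M _ _ x] h_ge by auto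
  qed
qed

end

text \<open>
  The competitors of \<open>H\<^sub>n\<close>.  An edge inside \<open>M\<close> makes \<open>u\<close> and \<open>W\<close> an independent set, so that all
  adjacencies are known up to the matching inside \<open>M\<close> and its position relative to \<open>b\<close>.
\<close>

locale missed_vertex_with_edge = half_missed_vertex +
  assumes edge: "(\<Sum>m\<in>M. card (nbh m \<inter> M)) \<noteq> 0"
begin

text \<open>
  The number of edges inside \<open>M\<close>.
\<close>

definition k :: nat where "k = (\<Sum>m\<in>M. card (nbh m \<inter> M)) div 2"
definition B :: "'a set" where "B = nbh b \<inter> M"
text \<open>
  The vertices adjacent to \<open>b\<close> and matched inside \<open>M\<close>.  Their defect may vanish, and their number
  has to be bounded.
\<close>

definition C :: "'a set" where "C = {m \<in> B. nbh m \<inter> M \<noteq> {}}"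

lemma k_basic: "(\<Sum>m\<in>M. card (nbh m \<inter> M)) = 2 * k" "k \<ge> 1" "2 * k < h" "card B + k = h"
proof -
  show sum: "(\<Sum>m\<in>M. card (nbh m \<inter> M)) = 2 * k"
    unfolding k_def using even_sum_inner_degree[OF M_basic(1)] by simp
  show "k \<ge> 1" using edge sum by simp
  have "(\<Sum>m\<in>M. card (nbh m \<inter> M)) \<le> (\<Sum>m\<in>M. 1)" by (intro sum_mono M_degree_le)
  then have "2 * k \<le> h" using sum card_M by simp
  then show "2 * k < h" using odd_h by (cases "2 * k = h") auto
  show "card B + k = h" using b_degree sum card_M by (simp add: B_def)
qed

lemma B_C_sub: "B \<subseteq> M" "C \<subseteq> B" "finite B" "finite C"
  using M_basic(1) by (auto simp: B_def C_def)

lemma M_sub_nbh: "v \<in> insert u W \<Longrightarrow> M \<subseteq> nbh v"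
  using M_basic(4) W_basic(6) by auto

lemma outside_independent:
  assumes "v \<in> insert u W" "w \<in> insert u W"
  shows "w \<notin> nbh v"
proof
  assume adj: "w \<in> nbh v"
  obtain m where "m \<in> M" "card (nbh m \<inter> M) \<noteq> 0" using edge by (meson sum.neutral)
  then have "m \<in> M" "nbh m \<inter> M \<noteq> {}" by auto
  then obtain m' where m: "m \<in> M" "m' \<in> M" "m' \<in> nbh m" by blast
  show False
    using no_K4[of v m w m'] m adj M_sub_nbh[OF assms(1)] M_sub_nbh[OF assms(2)] nbh_sym by blast
qed

lemma nbh_outside: "w \<in> W \<Longrightarrow> nbh w = M"
proof
  assume w: "w \<in> W"
  show "M \<subseteq> nbh w" using w by (rule W_basic(6))
  show "nbh w \<subseteq> M"
  proof
    fix v assume v: "v \<in> nbh w"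
    then have "v \<notin> insert u W" using outside_independent[of w v] w by blast
    moreover have "v \<noteq> b" using W_basic(7)[OF w] v by blast
    ultimately show "v \<in> M" using W_basic(8) v nbh_subset by blast
  qed
qed

lemma nbh_b: "nbh b = insert u B"
  using nbh_b_M by (simp add: B_def)

lemma nbh_M:
  assumes m: "m \<in> M"
  shows "nbh m = insert u W \<union> ((nbh m \<inter> M) \<union> (if m \<in> B then {b} else {}))"
proof -
  have "insert u W \<subseteq> nbh m" using m M_sub_nbh nbh_sym by blast
  moreover have "b \<in> nbh m \<longleftrightarrow> m \<in> B" using m nbh_sym by (auto simp: B_def)
  moreover have "nbh m \<subseteq> insert u (insert b (M \<union> W))" using nbh_subset W_basic(8) by metis
  ultimately show ?thesis by (auto split: if_splits)
qed

lemma sum_nbh_M: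
  fixes f :: "'a \<Rightarrow> int"
  assumes m: "m \<in> M"
  shows "(\<Sum>v\<in>nbh m. f v) =
    f u + (\<Sum>w\<in>W. f w) + (\<Sum>v\<in>nbh m \<inter> M. f v) + (if m \<in> B then f b else 0)"
proof -
  have "u \<noteq> b" using b_mem(1) by auto
  then have "(\<Sum>v\<in>nbh m. f v) = (\<Sum>v\<in>insert u W. f v) +
      (\<Sum>v\<in>(nbh m \<inter> M) \<union> (if m \<in> B then {b} else {}). f v)"
    using W_basic(1,4,5) M_basic(1,3)
    by (subst nbh_M[OF m], intro sum.union_disjoint) (auto split: if_splits)
  also have "(\<Sum>v\<in>insert u W. f v) = f u + (\<Sum>w\<in>W. f w)"
    using W_basic(1,3) by simp
  also have "(\<Sum>v\<in>(nbh m \<inter> M) \<union> (if m \<in> B then {b} else {}). f v) =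
      (\<Sum>v\<in>nbh m \<inter> M. f v) + (if m \<in> B then f b else 0)"
    using M_basic(1) b_mem(3) by (auto simp: add.commute)
  finally show ?thesis by simp
qed

lemma degrees:
  "deg u = h + 1" "w \<in> W \<Longrightarrow> deg w = h" "int (deg b) = int h - int k + 1"
  "m \<in> M \<Longrightarrow> int (deg m) = int h - 1 + int (card (nbh m \<inter> M)) + (if m \<in> B then 1 else 0)"
proof -
  show "deg u = h + 1" using M_basic(5) card_M by simp
  show "deg w = h" if "w \<in> W" using nbh_outside[OF that] card_M by (simp add: deg_def)
  have "u \<notin> B" using M_basic(3) B_C_sub(1) by blast
  then have "deg b = card B + 1" unfolding deg_def nbh_b using B_C_sub(3) by simp
  then show "int (deg b) = int h - int k + 1" using k_basic(4) by linarith
  assume m: "m \<in> M"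
  have "int (deg m) = (\<Sum>v\<in>nbh m. 1)" by (simp add: deg_def)
  also have "\<dots> = int h - 1 + int (card (nbh m \<inter> M)) + (if m \<in> B then 1 else 0)"
    unfolding sum_nbh_M[OF m] using card_W h_ge by auto
  finally show "int (deg m) = int h - 1 + int (card (nbh m \<inter> M)) + (if m \<in> B then 1 else 0)" .
qed

lemma defect_W:
  assumes "w \<in> W"
  shows "defect w = int h - int k"
proof -
  have "excess w = (\<Sum>m\<in>M. int h - 2 + int (card (nbh m \<inter> M)) + (if m \<in> B then 1 else 0))"
    unfolding excess_def nbh_outside[OF assms] by (intro sum.cong) (simp_all add: degrees(4))
  also have "\<dots> = int h * (int h - 2) + int (2 * k) + int (card B)"
    using card_M B_C_sub(1) M_basic(1)
    by (simp add: sum.distrib k_basic(1) sum.inter_restrict[symmetric] Int_absorb1 flip: of_nat_sum)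
  finally show ?thesis
    using card_V k_basic(4) by (simp add: defect_def power2_eq_square algebra_simps)
qed

lemma defect_M:
  assumes m: "m \<in> M"
  shows "defect m = 2 * int h - 2 - (\<Sum>v\<in>nbh m \<inter> M. int (deg v) - 1)
    - (if m \<in> B then int h - int k else 0)"
proof -
  have "(\<Sum>w\<in>W. int (deg w) - 1) = (int h - 2) * (int h - 1)"
    using degrees(2) card_W h_ge by (simp add: of_nat_diff)
  then show ?thesis
    unfolding defect_def excess_def sum_nbh_M[OF m] using card_V
    by (simp add: degrees(1,3) power2_eq_square algebra_simps)
qed

lemma defect_isolated:
  assumes "m \<in> M" "nbh m \<inter> M = {}"
  shows "defect m \<ge> int h - 2 + int k"
  using defect_M[OF assms(1)] assms(2) k_basic by auto

lemma defect_outside_C: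
  assumes m: "m \<in> M - C"
  shows "defect m \<ge> int h - 2"
proof (cases "nbh m \<inter> M = {}")
  case True
  then show ?thesis using defect_isolated m by force
next
  case False
  then have nB: "m \<notin> B" using m by (simp add: C_def)
  have "(\<Sum>v\<in>nbh m \<inter> M. int (deg v) - 1) \<le> (\<Sum>v\<in>nbh m \<inter> M. int h)"
    using degrees(4) M_degree_le by (intro sum_mono) fastforce
  also have "\<dots> = int (card (nbh m \<inter> M)) * int h" by simp
  also have "\<dots> \<le> 1 * int h" using M_degree_le[of m] m by (intro mult_right_mono) auto
  finally show ?thesis using defect_M[of m] nB m by simp
qed

text \<open>
  The vertex \<open>b\<close> is adjacent to at most one end of each edge inside \<open>M\<close>, as the other case is a
  triangle in the neighbourhood of \<open>u\<close>.
\<close>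

lemma card_C_le: "card C \<le> k"
proof -
  have one: "card (nbh m \<inter> M) = (if m \<in> C then 1 else 0)" if m: "m \<in> B" for m
  proof (cases "m \<in> C")
    case True
    then have "nbh m \<inter> M \<noteq> {}" by (simp add: C_def)
    then have "0 < card (nbh m \<inter> M)" using M_basic(1) by (simp add: card_gt_0_iff)
    moreover have "card (nbh m \<inter> M) \<le> 1" using m B_C_sub(1) by (intro M_degree_le) auto
    ultimately have "card (nbh m \<inter> M) = 1" by linarith
    then show ?thesis using True by simp
  qed (use m in \<open>simp add: C_def\<close>)
  have tri: "nbh m \<inter> B = {}" if m: "m \<in> B" for m
  proof (rule ccontr)
    assume "nbh m \<inter> B \<noteq> {}"
    then obtain m' where m': "m' \<in> nbh m" "m' \<in> B" by blast
    have "m \<in> nbh u" "m' \<in> nbh u" "m \<in> nbh b" "m' \<in> nbh b"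
      using m m' M_basic(4) by (auto simp: B_def)
    then show False using no_K4[of b u m m'] b_mem(1) m' by blast
  qed
  have "card C = (\<Sum>m\<in>B. card (nbh m \<inter> M))"
    using B_C_sub by (simp add: one sum.inter_restrict[symmetric] Int_absorb1)
  also have "\<dots> = (\<Sum>m\<in>M. card (nbh m \<inter> B))"
    using double_counting[OF B_C_sub(3) M_basic(1)] .
  also have "\<dots> = (\<Sum>m\<in>M - B. card (nbh m \<inter> B))"
    using tri M_basic(1) B_C_sub(1) by (intro sum.mono_neutral_right) auto
  also have "\<dots> \<le> (\<Sum>m\<in>M - B. card (nbh m \<inter> M))"
    using B_C_sub(1) by (intro sum_mono card_mono) auto
  finally have 1: "card C \<le> (\<Sum>m\<in>M - B. card (nbh m \<inter> M))" .
  have "2 * k = (\<Sum>m\<in>M - B. card (nbh m \<inter> M)) + (\<Sum>m\<in>B. card (nbh m \<inter> M))"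
    unfolding k_basic(1)[symmetric] using M_basic(1) B_C_sub(1) by (intro sum.subset_diff) auto
  also have "(\<Sum>m\<in>B. card (nbh m \<inter> M)) = card C"
    using B_C_sub by (simp add: one sum.inter_restrict[symmetric] Int_absorb1)
  finally show ?thesis using 1 by simp
qed

lemma adj_defect_ge:
  assumes "S \<subseteq> nbh v" "\<And>s. s \<in> S \<Longrightarrow> defect s \<ge> c"
  shows "adj defect v \<ge> int (card S) * c"
proof -
  have "int (card S) * c = (\<Sum>s\<in>S. c)" by simp
  also have "\<dots> \<le> (\<Sum>s\<in>S. defect s)" using assms(2) by (intro sum_mono)
  also have "\<dots> \<le> (\<Sum>s\<in>nbh v. defect s)"
    using assms(1) defect_nonneg[OF card_V] nbh_subset by (intro sum_mono2) auto
  finally show ?thesis by (simp add: adj_def)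
qed

text \<open>
  Every vertex other than \<open>b\<close> is adjacent to all of \<open>W\<close> or to all of \<open>M\<close>, and the defects in each
  of these sets add up to at least \<open>3 (h - 2) > h\<close>.
  At \<open>b\<close> the sum may be equal to \<open>h\<close>, which is harmless, because the eigenvector does not vanish
  everywhere else.
\<close>

lemma large_case:
  assumes h5: "h \<ge> 5" and x: "nonneg_eigenvector x r"
  shows "cubic h r < 0"
proof -
  have hk: "int h - int k \<ge> 3" using k_basic(3) h5 by linarith
  have big: "int h < c * d" if "c \<ge> 3" "d \<ge> int h - 2" for c d :: int
  proof -
    have "int h < 3 * (int h - 2)" using h5 by simp
    also have "\<dots> \<le> c * d" using that h5 by (intro mult_mono) auto
    finally show ?thesis .
  qed
  have strict: "int h < adj defect v" if v: "v \<in> V" "v \<noteq> b" for v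
  proof (cases "v \<in> M")
    case True
    then have "W \<subseteq> nbh v" using nbh_M by blast
    then have "int (card W) * (int h - int k) \<le> adj defect v"
      using defect_W by (intro adj_defect_ge) auto
    moreover have "int h < (int h - int k) * int (card W)"
      using card_W h5 hk by (intro big) auto
    ultimately show ?thesis by (simp add: mult.commute)
  next
    case False
    then have "M - C \<subseteq> nbh v" using M_sub_nbh v W_basic(8) by blast
    then have "int (card (M - C)) * (int h - 2) \<le> adj defect v"
      using defect_outside_C by (intro adj_defect_ge) auto
    moreover have "card (M - C) = h - card C"
      using B_C_sub card_M by (subst card_Diff_subset) auto
    then have "int h < int (card (M - C)) * (int h - 2)"
      using card_C_le hk by (intro big) auto
    ultimately show ?thesis by simp
  qed
  have at_b: "int h \<le> adj defect b"
  proof -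
    have "int (card (B - C)) * (int h - 2 + int k) \<le> adj defect b"
    proof (rule adj_defect_ge)
      show "B - C \<subseteq> nbh b" by (auto simp: B_def)
      show "int h - 2 + int k \<le> defect s" if "s \<in> B - C" for s
        using that B_C_sub(1) by (intro defect_isolated) (auto simp: C_def)
    qed
    moreover have "int h \<le> int (card (B - C)) * (int h - 2 + int k)"
    proof -
      have c: "card (B - C) = card B - card C" using B_C_sub by (simp add: card_Diff_subset)
      show ?thesis
      proof (cases "k = 1")
        case True
        then have "int (card (B - C)) \<ge> 3" using c k_basic(4) card_C_le h5 by linarith
        then show ?thesis using big[of "int (card (B - C))" "int h - 2 + int k"] by simp
      next
        case False
        have "1 * int h \<le> int (card (B - C)) * (int h - 2 + int k)"
          using False c k_basic card_C_le h5 by (intro mult_mono) auto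
        then show ?thesis by simp
      qed
    qed
    ultimately show ?thesis by simp
  qed
  obtain a where a: "a \<in> V" "x a > 0" "a \<noteq> b"
  proof -
    obtain a where a: "a \<in> V" "x a > 0" using x by (auto simp: nonneg_eigenvector_def)
    show thesis
    proof (cases "a = b")
      case True
      have nn: "x v \<ge> 0" if "v \<in> V" for v using x that by (auto simp: nonneg_eigenvector_def)
      have "x b \<le> adj x u"
        unfolding adj_def using b_mem(1) nn nbh_subset by (intro member_le_sum) auto
      then have "0 < r * x u" using x u a True by (simp add: nonneg_eigenvector_def)
      then have "x u \<noteq> 0" by auto
      then have "x u > 0" using nn[OF u] by simp
      moreover have "u \<noteq> b" using b_mem(1) by auto
      ultimately show thesis using that u by blast
    qed (use that a in blast)
  qed
  show ?thesis
  proof (rule cubic_neg_if_adj_defect[OF x card_V _ a(1,2)])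
    show "int h \<le> adj defect v" if "v \<in> V" for v
      using strict[OF that] at_b by (cases "v = b") auto
    show "int h < adj defect a" using strict[OF a(1,3)] .
  qed
qed

text \<open>
  There is only one such graph on six vertices.  At its vertices \<open>b\<close> and \<open>m'\<close> the defects of the
  neighbours add up to \<open>2 < h\<close>, so the bound is obtained from a test vector instead.
\<close>

lemma small_case:
  assumes h3: "h = 3" and x: "nonneg_eigenvector x r"
  shows "r \<le> 339 / 100"
proof -
  have k1: "k = 1" using k_basic(2,3) h3 by simp
  obtain w where W: "W = {w}" using card_W h3 by (auto simp: card_1_singleton_iff)
  have cB: "card B = 2" using k_basic(4) k1 h3 by simp
  have "\<not> B \<subseteq> C"
  proof
    assume "B \<subseteq> C"
    then have "card B \<le> card C" by (rule card_mono[OF B_C_sub(4)])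
    then show False using card_C_le cB k1 by simp
  qed
  then obtain m0 where m0: "m0 \<in> B" "m0 \<in> M" "nbh m0 \<inter> M = {}"
    using B_C_sub(1) by (auto simp: C_def)
  have "card (B - {m0}) = 1" using cB m0(1) by simp
  then obtain m where "B - {m0} = {m}" by (elim card_1_singletonE)
  then have m: "B = {m0, m}" "m \<noteq> m0" using m0(1) by auto
  have "card (M - {m0, m}) = 1"
    using card_M h3 B_C_sub(1) m M_basic(1) by (subst card_Diff_subset) auto
  then obtain m' where m': "M - {m0, m} = {m'}" by (auto simp: card_1_singleton_iff)
  have M: "M = {m0, m, m'}" "m' \<noteq> m0" "m' \<noteq> m" using m' m B_C_sub(1) by auto
  have "card (nbh m \<inter> M) + card (nbh m' \<inter> M) = 2"
    using k_basic(1) k1 m0(3) m(2) M(2,3) unfolding M(1) by simp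
  moreover have "card (nbh m \<inter> M) \<le> 1" "card (nbh m' \<inter> M) \<le> 1"
    by (intro M_degree_le; simp add: M(1))+
  ultimately have "card (nbh m \<inter> M) \<noteq> 0" by linarith
  then have "nbh m \<inter> M \<noteq> {}" by auto
  moreover have "m0 \<notin> nbh m" using m0(3) nbh_sym M(1) by blast
  ultimately have mm': "m' \<in> nbh m" using M(1) by auto
  then have mM: "nbh m \<inter> M = {m'}" "nbh m' \<inter> M = {m}"
    using \<open>m0 \<notin> nbh m\<close> m0(3) nbh_sym[of m0 m'] nbh_sym[of m m'] M(1) by auto
  have inM: "m \<in> M" "m' \<in> M" "m' \<notin> B" using M m by auto
  have ne: "u \<noteq> b" "u \<notin> M" "b \<notin> M" "w \<noteq> u" "w \<noteq> b" "w \<notin> M"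
    using b_mem M_basic(3) W_basic W by auto
  have dist: "u \<noteq> w" "u \<noteq> m" "u \<noteq> m'" "u \<noteq> m0" "b \<noteq> u" "b \<noteq> w" "b \<noteq> m" "b \<noteq> m'" "b \<noteq> m0"
    "w \<noteq> m" "w \<noteq> m'" "w \<noteq> m0" "m \<noteq> m0" "m' \<noteq> m0" "m' \<noteq> m"
    using ne M m(2) by auto
  note dist' = dist dist[symmetric]
  have nb: "nbh u = {b, m0, m, m'}" "nbh w = {m0, m, m'}" "nbh b = {u, m0, m}"
    "nbh m = {u, w, m', b}" "nbh m' = {u, w, m}" "nbh m0 = {u, w, b}"
    using M_basic(4) nbh_outside[of w] nbh_b nbh_M[OF inM(1)] nbh_M[OF inM(2)] nbh_M[OF m0(2)]
      W m(1) m0(1,3) mM inM(3) unfolding M(1) by auto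
  \<comment> \<open>The graph has an equitable partition into \<open>{u, m}\<close>, \<open>{w, m0}\<close> and \<open>{b, m'}\<close>; the values
    approximate its Perron vector, with eigenvalue about \<open>3.3885\<close>, while \<open>\<rho>(H\<^sub>6)\<close> is about \<open>3.392\<close>.\<close>
  define y :: "'a \<Rightarrow> real"
    where "y v = (if v = u \<or> v = m then 200 else if v = w \<or> v = m0 then 152 else 163)" for v
  show ?thesis
  proof (rule test_vector_bound[OF x])
    fix v assume "v \<in> V"
    show "y v > 0" by (simp add: y_def)
    have "v = u \<or> v = b \<or> v = w \<or> v = m0 \<or> v = m \<or> v = m'"
      using \<open>v \<in> V\<close> W_basic(8) W M(1) by auto
    then show "adj y v \<le> 339 / 100 * y v"
      by (elim disjE; simp add: adj_def nb y_def dist')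
  qed
qed

end

context acyclic_nbh_graph
begin

text \<open>
  A vertex of defect \<open>0\<close> is of path type by parity, has degree \<open>h + 1\<close>, and each of its \<open>h - 2\<close>
  non-neighbours misses one vertex.  For \<open>h \<ge> 5\<close> this is always the same vertex by \<open>missed_vertex_unique\<close>; for
  \<open>h = 3\<close> there is only one non-neighbour.
\<close>

lemma two_mod_four_dichotomy:
  assumes n: "card V = 2 * h" and odd_h: "odd h" and h3: "h \<ge> 3"
    and x: "nonneg_eigenvector x r" and r: "r > real h"
  shows "(\<exists>D I. matching_join D I \<and> card D = h \<and> card I = h \<and> card (unmatched D) = 1) \<or>
    cubic h r < 0 \<or> (h = 3 \<and> r \<le> 339 / 100)"
proof (cases "\<forall>v\<in>V. defect v \<ge> 1")
  case True
  then show ?thesis using cubic_neg_if_defect_pos[OF x n r] by blast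
next
  case False
  then obtain u where u: "u \<in> V" "\<not> defect u \<ge> 1" by blast
  then have "defect u = 0" using defect_nonneg[OF n u(1)] by simp
  then have ex: "excess u = int h * int h" using n by (simp add: defect_def power2_eq_square)
  then have tight: "(int (card V))\<^sup>2 \<le> 4 * excess u + 1" using n by (simp add: power2_eq_square)
  have "nbh u \<noteq> {}" using ex h3 by (auto simp: excess_def)
  moreover have "card V mod 4 = 2" using n odd_h by presburger
  ultimately have path: "\<not> matching_type u"
    using matching_type_tight_join(4)[OF u(1) _ tight] by blast
  note t = path_type_tight[OF u(1) path tight]
  have "\<bar>int (card V) + 2 - 2 * int (deg u)\<bar> \<le> 1" using t(1) by (simp add: abs_square_le_1)
  then have d: "deg u = h + 1" using n by linarith
  define W where "W = V - nbh u - {u}"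
  have cW: "card W = h - 2" using card_non_nbh[OF u(1)] n d by (simp add: W_def)
  have fW: "finite W" using finite_V by (simp add: W_def)
  have "W \<noteq> {}" using cW h3 by auto
  then obtain w where w: "w \<in> W" by blast
  have miss: "\<exists>b. nbh u - nbh w = {b}" if "w \<in> W" for w
    using t(3) that by (auto simp: W_def card_1_singleton_iff)
  then obtain b where b: "nbh u - nbh w = {b}" using w by blast
  have common: "nbh u - nbh w' = {b}" if w': "w' \<in> W" for w'
  proof (cases "h = 3")
    case True
    then have "card W = 1" using cW by simp
    then have "w' = w" using w w' by (auto simp: card_1_singleton_iff)
    then show ?thesis using b by simp
  next
    case False
    then have "deg u \<ge> 6" using d h3 odd_h by (cases "h = 4") auto
    obtain b' where b': "nbh u - nbh w' = {b'}" using miss[OF w'] by blast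
    have "w \<noteq> u" "w' \<noteq> u" using w w' by (auto simp: W_def)
    then show ?thesis using missed_vertex_unique[OF t(2) \<open>deg u \<ge> 6\<close> _ b _ b'] b' by simp
  qed
  interpret missed_vertex V E u b
    using u(1) t(2) w common by unfold_locales (auto simp: W_def)
  interpret half_missed_vertex V E u b h
    using n d M_basic(5) odd_h h3 by unfold_locales auto
  show ?thesis
  proof (cases "(\<Sum>m\<in>M. card (nbh m \<inter> M)) = 0")
    case True
    then show ?thesis using star_case_structure[OF _ x] by blast
  next
    case False
    then interpret missed_vertex_with_edge V E u b h by unfold_locales
    show ?thesis
    proof (cases "h = 3")
      case True
      then show ?thesis using small_case[OF _ x] by blast
    next
      case False
      then have "h \<ge> 5" using h3 odd_h by (cases "h = 4") auto
      then show ?thesis using large_case[OF _ x] by blast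
    qed
  qed
qed

text \<open>
  The weighted average of the excess is at most its maximum \<open>\<lfloor>n\<^sup>2 / 4\<rfloor>\<close>, multiplied by four here to
  stay within the integers; equality forces it at every vertex in the support of the eigenvector.
\<close>

lemma radius_product_le:
  assumes x: "nonneg_eigenvector x r" and "V \<noteq> {}"
  shows "4 * (r * (r - 1)) \<le> real ((card V)\<^sup>2 - card V mod 2)"
    and "4 * (r * (r - 1)) = real ((card V)\<^sup>2 - card V mod 2) \<Longrightarrow> v \<in> V \<Longrightarrow> x v > 0 \<Longrightarrow>
      4 * excess v = (int (card V))\<^sup>2 - int (card V mod 2)"
proof -
  let ?c = "(card V)\<^sup>2 - card V mod 2"
  have "card V mod 2 \<le> (card V)\<^sup>2"
    by (metis mod_less_eq_dividend order_trans power2_nat_le_imp_le le_square power2_eq_square)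
  then have c: "int ?c = (int (card V))\<^sup>2 - int (card V mod 2)" by (simp add: of_nat_diff)
  have le: "4 * excess v \<le> int ?c" if "v \<in> V" for v
  proof (cases "even (card V)")
    case True
    then show ?thesis using excess_le[OF that] c by simp
  next
    case False
    then obtain k where "card V = 2 * k + 1" using oddE by blast
    then have k: "(int (card V))\<^sup>2 = 4 * (int k * int k + int k) + 1" "card V mod 2 = 1"
      by (simp_all add: power2_eq_square algebra_simps) presburger
    have "4 * excess v \<le> 4 * (int k * int k + int k) + 1"
      using excess_le[OF that] unfolding k(1) .
    then have "excess v \<le> int k * int k + int k" by presburger
    then show ?thesis using c k by simp
  qed
  have pos: "sum x V > 0" by (rule eigenvector_sum_pos[OF x])
  have eq: "(\<Sum>v\<in>V. x v * (real ?c - 4 * real_of_int (excess v))) =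
      (real ?c - 4 * (r * (r - 1))) * sum x V"
  proof -
    have "(\<Sum>v\<in>V. x v * (real ?c - 4 * real_of_int (excess v))) =
        (\<Sum>v\<in>V. real ?c * x v - 4 * (x v * excess v))"
      by (intro sum.cong) (simp_all only: algebra_simps)
    also have "\<dots> = real ?c * sum x V - 4 * (r * (r - 1) * sum x V)"
      unfolding sum_subtractf sum_distrib_left[symmetric] sum_mult_excess[OF x] ..
    finally show ?thesis by (simp only: algebra_simps)
  qed
  have nonneg: "x v * (real ?c - 4 * real_of_int (excess v)) \<ge> 0" if "v \<in> V" for v
  proof -
    have "4 * real_of_int (excess v) \<le> real ?c" using le[OF that] by linarith
    moreover have "x v \<ge> 0" using x that by (simp add: nonneg_eigenvector_def)
    ultimately show ?thesis by simp
  qed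
  have "0 \<le> (real ?c - 4 * (r * (r - 1))) * sum x V"
    unfolding eq[symmetric] using nonneg by (rule sum_nonneg)
  then show "4 * (r * (r - 1)) \<le> real ?c" using pos by (simp add: zero_le_mult_iff)
  assume eq0: "4 * (r * (r - 1)) = real ?c" and v: "v \<in> V" "x v > 0"
  have "(\<Sum>v\<in>V. x v * (real ?c - 4 * real_of_int (excess v))) = 0"
    unfolding eq using eq0 by simp
  then have "\<forall>v\<in>V. x v * (real ?c - 4 * real_of_int (excess v)) = 0"
    by (subst (asm) sum_nonneg_eq_0_iff[OF finite_V nonneg])
  then have "x v * (real ?c - 4 * real_of_int (excess v)) = 0" using v(1) by blast
  then have "real ?c = 4 * real_of_int (excess v)" using v(2) by simp
  then have "int ?c = 4 * excess v" by linarith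
  then show "4 * excess v = (int (card V))\<^sup>2 - int (card V mod 2)" using c by simp
qed

text \<open>
  If no vertex in the support of the eigenvector is of matching type, then the structure around one of
  them shows that the graph is connected, so that all vertices lie in the support.
\<close>

lemma extremal_structure:
  assumes x: "nonneg_eigenvector x r" and n: "card V \<ge> 4"
    and eq: "4 * (r * (r - 1)) = real ((card V)\<^sup>2 - card V mod 2)"
  obtains (join) D I where "matching_join D I" "unmatched D = {}" "card D = matching_size (card V)"
      "card V mod 4 \<noteq> 2"
    | (cycle) cs where "distinct cs" "set cs = V" "length cs = 7"
      "\<And>i j. i < 7 \<Longrightarrow> j < 7 \<Longrightarrow>
        cs ! j \<in> nbh (cs ! i) \<longleftrightarrow> j \<noteq> i \<and> j \<noteq> (i + 1) mod 7 \<and> i \<noteq> (j + 1) mod 7"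
proof -
  have ne: "V \<noteq> {}" using n by auto
  note tight_pos = radius_product_le(2)[OF x ne eq]
  have tight_le: "(int (card V))\<^sup>2 \<le> 4 * excess v + 1" if "v \<in> V" "x v > 0" for v
    using tight_pos[OF that] by simp
  have nbh_ne: "nbh v \<noteq> {}" if "v \<in> V" "x v > 0" for v
  proof
    assume "nbh v = {}"
    then have "(int (card V))\<^sup>2 \<le> 1" using tight_le[OF that] by (simp add: excess_def)
    moreover have "(int 4)\<^sup>2 \<le> (int (card V))\<^sup>2" using n by (intro power_mono) auto
    ultimately show False by simp
  qed
  show thesis
  proof (cases "\<exists>v\<in>V. x v > 0 \<and> matching_type v")
    case True
    then obtain v where v: "v \<in> V" "x v > 0" "matching_type v" by blast
    show thesis
      using matching_type_tight_join[OF v(1,3) tight_le[OF v(1,2)] nbh_ne[OF v(1,2)]]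
      by (rule join)
  next
    case False
    then have path: "\<not> matching_type v" if "v \<in> V" "x v > 0" for v using that by blast
    obtain u where u: "u \<in> V" "x u > 0" using x by (auto simp: nonneg_eigenvector_def)
    have nn: "x v \<ge> 0" if "v \<in> V" for v using x that by (auto simp: nonneg_eigenvector_def)
    \<comment> \<open>The support of the eigenvector is closed under adjacency, as the eigenvalue equation shows.\<close>
    have spread: "x v > 0" if "a \<in> V" "x a > 0" "a \<in> nbh v" for a v
    proof -
      have v: "v \<in> V" using that nbh_sym nbh_subset by blast
      have "x a \<le> adj x v"
        unfolding adj_def using that(3) nn nbh_subset by (intro member_le_sum) auto
      then have "0 < r * x v" using x v that by (simp add: nonneg_eigenvector_def)
      then have "x v \<noteq> 0" by auto
      then show ?thesis using nn[OF v] by simp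
    qed
    note t = path_type_tight[OF u(1) path[OF u] tight_le[OF u]]
    have "2 \<le> deg u"
    proof -
      have "\<bar>int (card V) + 2 - 2 * int (deg u)\<bar> \<le> 1" using t(1) by (simp add: abs_square_le_1)
      then show ?thesis using n by linarith
    qed
    have all_pos: "x v > 0" if v: "v \<in> V" for v
    proof -
      have nb: "x a > 0" "a \<in> V" if "a \<in> nbh u" for a
        using spread[OF u] that nbh_sym nbh_subset by blast+
      consider "v = u" | "v \<in> nbh u" | "v \<in> V - nbh u - {u}" using v by blast
      then show ?thesis
      proof cases
        case 3
        have "\<not> nbh u \<subseteq> nbh u - nbh v"
        proof
          assume "nbh u \<subseteq> nbh u - nbh v"
          then have "nbh u - nbh v = nbh u" by blast
          then show False using t(3)[OF 3] \<open>2 \<le> deg u\<close> by (simp add: deg_def)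
        qed
        then obtain a where "a \<in> nbh u" "a \<in> nbh v" by blast
        then show ?thesis using spread[of a v] nb by blast
      qed (use u nb in auto)
    qed
    show thesis
      using all_path_type_complement_C7[OF path n tight_pos] all_pos cycle by metis
  qed
qed

end

text \<open>
  Above \<open>h\<close> the polynomial changes sign only once: for a root \<open>r > h\<close> the cofactor of \<open>t - r\<close> is
  nonnegative on \<open>t \<ge> r\<close>.
\<close>

lemma cubic_nonneg_above_root:
  assumes "cubic h r = 0" "real h < r" "h \<ge> 1" "r \<le> t"
  shows "cubic h t \<ge> 0"
proof -
  have r1: "r > 1" using assms by linarith
  have "t * r \<ge> r * r" "t * t \<ge> t" using assms r1 by (auto intro: mult_right_mono simp: mult_le_cancel_right1)
  have "r * (r\<^sup>2 - r - (real h)\<^sup>2) = - real h"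
    using assms(1) by (simp add: cubic_def algebra_simps power2_eq_square power3_eq_cube)
  moreover have "real h \<le> r" using assms by simp
  ultimately have "r * (r\<^sup>2 - r - (real h)\<^sup>2) \<ge> r * (- 1)" by simp
  then have "r\<^sup>2 - r - (real h)\<^sup>2 \<ge> - 1" using r1 by (simp only: mult_le_cancel_left_pos)
  moreover have "t * r \<ge> 1 * 1" using assms r1 by (intro mult_mono) auto
  ultimately have q: "t\<^sup>2 - t + t * r + (r\<^sup>2 - r - (real h)\<^sup>2) \<ge> 0"
    using \<open>t * t \<ge> t\<close> by (simp add: power2_eq_square)
  have "cubic h t = cubic h t - cubic h r" using assms(1) by simp
  also have "\<dots> = (t - r) * (t\<^sup>2 - t + t * r + (r\<^sup>2 - r - (real h)\<^sup>2))"
    by (simp add: cubic_def algebra_simps power2_eq_square power3_eq_cube)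
  finally show ?thesis using q assms(4) by simp
qed

text \<open>
  The polynomial changes sign between \<open>h\<close> and \<open>h + 1\<close>.
\<close>

lemma cubic_root:
  assumes "h \<ge> 2"
  obtains r where "cubic h r = 0" "real h < r"
proof -
  have lo: "cubic h (real h) < 0"
  proof -
    have "cubic h (real h) = real h - real h * real h"
      by (simp add: cubic_def power2_eq_square power3_eq_cube)
    also have "\<dots> < 0" using assms by simp
    finally show ?thesis .
  qed
  have hi: "cubic h (real h + 1) \<ge> 0"
    by (simp add: cubic_def power2_eq_square power3_eq_cube algebra_simps)
  have "continuous_on {real h..real h + 1} (cubic h)"
    unfolding cubic_def by (intro continuous_intros)
  then obtain r where "real h \<le> r" "r \<le> real h + 1" "cubic h r = 0"
    using IVT'[of "cubic h" "real h" 0 "real h + 1"] lo hi by auto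
  then show thesis using that[of r] lo by (cases "r = real h") auto
qed

section \<open>The spectral radius of the extremal graphs\<close>

lemma matching_size_two_mod_four:
  assumes "n = 2 * h" "odd h"
  shows "matching_size n = h"
proof -
  obtain k where k: "h = 2 * k + 1" using assms(2) oddE by blast
  have n: "n = 4 * k + 2" using assms(1) k by simp
  then have "n mod 4 = 2" "(n + 1) div 4 = k" by presburger+
  then show ?thesis using k by (simp add: matching_size_def)
qed

lemma rho_A_H_graph_cubic:
  assumes n: "n = 2 * h" "odd h" "h \<ge> 3" and r: "cubic h r = 0" "real h < r"
  shows "rho_A (H_graph n) = r"
proof -
  obtain D I where mj: "simple_graph.matching_join (pverts (H_graph n)) (parcs (H_graph n)) D I"
    and c: "card D = matching_size n" "card I = n - matching_size n"
      "card (simple_graph.unmatched (parcs (H_graph n)) D) = (if n mod 4 = 2 then 1 else 0)"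
    by (rule H_graph_matching_join)
  have "n mod 4 = 2" using n by presburger
  moreover have "matching_size n = h" using n(1,2) by (rule matching_size_two_mod_four)
  ultimately have cards: "card D = h" "card I = h"
    "card (simple_graph.unmatched (parcs (H_graph n)) D) = 1" using c n by auto
  interpret simple_graph "pverts (H_graph n)" "parcs (H_graph n)"
    by (intro pair_graph_simple_graph pair_graph_H_graph)
  have "pverts (H_graph n) \<noteq> {}" using card_H_graph[of n] n by auto
  then obtain x where x: "nonneg_eigenvector x (rho_A (H_graph n))"
    using rho_A_nonneg_eigenvector[OF pair_graph_H_graph] by blast
  show ?thesis
  proof (rule matching_join_radius[OF mj _ _ _ x])
    show "I \<noteq> {}" using cards n by auto
    show "r > 1" using r n by linarith
    show "r\<^sup>2 * (r - 1) + real (card (unmatched D)) * real (card I) = real (card D) * real (card I) * r"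
      using r(1) cards by (simp add: cubic_def algebra_simps power2_eq_square power3_eq_cube)
  qed
qed

lemma rho_A_H_graph_quadratic:
  assumes n: "n \<ge> 4" "n mod 4 \<noteq> 2"
  shows "rho_A (H_graph n) > 1"
    and "4 * (rho_A (H_graph n) * (rho_A (H_graph n) - 1)) = real (n\<^sup>2 - n mod 2)"
proof -
  obtain D I where mj: "simple_graph.matching_join (pverts (H_graph n)) (parcs (H_graph n)) D I"
    and c: "card D = matching_size n" "card I = n - matching_size n"
      "card (simple_graph.unmatched (parcs (H_graph n)) D) = (if n mod 4 = 2 then 1 else 0)"
    by (rule H_graph_matching_join)
  interpret simple_graph "pverts (H_graph n)" "parcs (H_graph n)"
    by (intro pair_graph_simple_graph pair_graph_H_graph)
  have "pverts (H_graph n) \<noteq> {}" using card_H_graph[of n] n by auto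
  then obtain x where x: "nonneg_eigenvector x (rho_A (H_graph n))"
    using rho_A_nonneg_eigenvector[OF pair_graph_H_graph] by blast
  define p q where "p = matching_size n" and "q = n - matching_size n"
  have pq: "4 * (p * q) = n\<^sup>2 - n mod 2 \<and> q \<ge> 2 \<and> p \<ge> 2"
  proof -
    define k where "k = n div 4"
    have "n mod 4 < 4" by simp
    then have "n mod 4 = 0 \<or> n mod 4 = 1 \<or> n mod 4 = 3" using n(2) by linarith
    then consider "n = 4 * k" | "n = 4 * k + 1" | "n = 4 * k + 3"
      using div_mult_mod_eq[of n 4] unfolding k_def by linarith
    then show ?thesis
    proof cases
      case 1
      then have "(n + 1) div 4 = k" "n mod 2 = 0" by presburger+
      then have "p = 2 * k" "q = 2 * k" "n mod 2 = 0" using n 1 by (auto simp: p_def q_def matching_size_def)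
      then show ?thesis using 1 n(1) by (simp add: power2_eq_square)
    next
      case 2
      then have "(n + 1) div 4 = k" "n mod 2 = 1" by presburger+
      then have "p = 2 * k" "q = 2 * k + 1" "n mod 2 = 1" using n 2 by (auto simp: p_def q_def matching_size_def)
      then show ?thesis using 2 n(1) by (simp add: power2_eq_square algebra_simps)
    next
      case 3
      then have "(n + 1) div 4 = k + 1" "n mod 2 = 1" by presburger+
      then have "p = 2 * k + 2" "q = 2 * k + 1" "n mod 2 = 1" using n 3 by (auto simp: p_def q_def matching_size_def)
      then show ?thesis using 3 n(1) by (simp add: power2_eq_square algebra_simps)
    qed
  qed
  define r where "r = (1 + sqrt (1 + 4 * real (p * q))) / 2"
  have "0 < real (p * q)" using pq by simp
  then have "sqrt (1 + 4 * real (p * q)) > sqrt 1" by (intro real_sqrt_less_mono) simp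
  then have r1: "r > 1" by (simp add: r_def)
  have "2 * r - 1 = sqrt (1 + 4 * real (p * q))" by (simp add: r_def field_simps)
  then have "(2 * r - 1)\<^sup>2 = 1 + 4 * real (p * q)" by simp
  then have req: "r * (r - 1) = real (p * q)" by (simp add: power2_eq_square algebra_simps)
  have "rho_A (H_graph n) = r"
  proof (rule matching_join_radius[OF mj _ r1 _ x])
    show "I \<noteq> {}" using c pq q_def by auto
    have "r\<^sup>2 * (r - 1) = r * real (p * q)" unfolding req[symmetric] by (simp add: power2_eq_square)
    then show "r\<^sup>2 * (r - 1) + real (card (unmatched D)) * real (card I) = real (card D) * real (card I) * r"
      using c n by (simp add: p_def q_def)
  qed
  then show "rho_A (H_graph n) > 1"
    "4 * (rho_A (H_graph n) * (rho_A (H_graph n) - 1)) = real (n\<^sup>2 - n mod 2)"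
    using r1 req pq by (simp_all flip: of_nat_mult)
qed

lemma F_graph_arcs:
  "(u, v) \<in> parcs F_graph \<longleftrightarrow> u < 7 \<and> v < 7 \<and> u \<noteq> v \<and> v \<noteq> (u + 1) mod 7 \<and> u \<noteq> (v + 1) mod 7"
  by (auto simp: F_graph_def complement_graph_def cycle_graph_def)

lemma rho_A_F_graph: "rho_A F_graph = 4"
proof -
  interpret simple_graph "pverts F_graph" "parcs F_graph"
    by (intro pair_graph_simple_graph pair_graph_F_graph)
  have V: "pverts F_graph = {..<7}"
    by (simp add: F_graph_def complement_graph_def cycle_graph_def)
  then have "pverts F_graph \<noteq> {}" by (metis empty_iff lessThan_iff zero_less_numeral)
  then obtain x where x: "nonneg_eigenvector x (rho_A F_graph)"
    using rho_A_nonneg_eigenvector[OF pair_graph_F_graph] by blast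
  show ?thesis
  proof (rule positive_eigenvector_unique[OF x, of "\<lambda>_. 1"])
    fix u assume "u \<in> pverts F_graph"
    then have u: "u < 7" by (simp add: V)
    have "nbh u = set (filter (\<lambda>v. u \<noteq> v \<and> v \<noteq> (u + 1) mod 7 \<and> u \<noteq> (v + 1) mod 7) [0..<7])"
      using u by (auto simp: nbh_def F_graph_arcs)
    then have "card (nbh u) = length (filter (\<lambda>v. u \<noteq> v \<and> v \<noteq> (u + 1) mod 7 \<and> u \<noteq> (v + 1) mod 7) [0..<7])"
      by (simp only: distinct_card[OF distinct_filter[OF distinct_upt]])
    moreover have "u = 0 \<or> u = 1 \<or> u = 2 \<or> u = 3 \<or> u = 4 \<or> u = 5 \<or> u = 6" using u by auto
    ultimately have "card (nbh u) = 4" by (elim disjE; simp add: upt_rec)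
    then show "adj (\<lambda>_. 1) u = 4 * (1 :: real)" by (simp add: adj_def)
  qed simp
qed

lemma digraph_iso_F_graph:
  assumes G: "pair_graph G" and cs: "distinct cs" "set cs = pverts G" "length cs = 7"
    and adj: "\<And>i j. i < 7 \<Longrightarrow> j < 7 \<Longrightarrow> (cs ! i, cs ! j) \<in> parcs G \<longleftrightarrow>
      j \<noteq> i \<and> j \<noteq> (i + 1) mod 7 \<and> i \<noteq> (j + 1) mod 7"
  shows "digraph_iso (with_proj G) (with_proj F_graph)"
proof -
  have V: "pverts F_graph = {..<7}"
    by (simp add: F_graph_def complement_graph_def cycle_graph_def)
  interpret F: pair_graph F_graph by (rule pair_graph_F_graph)
  have "digraph_iso (with_proj F_graph) (with_proj G)"
  proof (rule digraph_isoI[OF pair_graph_F_graph G])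
    show "bij_betw ((!) cs) (pverts F_graph) (pverts G)"
      unfolding V using cs by (intro bij_betw_nth) auto
    show "(i, j) \<in> parcs F_graph \<longleftrightarrow> (cs ! i, cs ! j) \<in> parcs G"
      if "i \<in> pverts F_graph" "j \<in> pverts F_graph" for i j
      using that adj unfolding V by (auto simp: F_graph_arcs)
  qed
  with F.wf_digraph show ?thesis by (rule digraph_iso_swap)
qed

section \<open>The extremal theorem\<close>

text \<open>
  What this leaves for the theorem is that \<open>H\<^sub>n\<close>, and for \<open>n = 7\<close> also \<open>F\<close>, attain the bound.
\<close>

lemma wheel_free_bound:
  fixes G :: "'a pair_pre_digraph"
  assumes G: "pair_graph G" and n: "card (pverts G) = n" "n \<ge> 4" and wf: "wheel_free G"
  shows "rho_A G < rho_A (H_graph n) \<or> digraph_iso (with_proj G) (with_proj (H_graph n)) \<or>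
    (n = 7 \<and> digraph_iso (with_proj G) (with_proj F_graph))"
proof -
  interpret acyclic_nbh_graph "pverts G" "parcs G" using wheel_free_acyclic_nbh[OF G wf] .
  have ne: "pverts G \<noteq> {}" using n by auto
  obtain x where x: "nonneg_eigenvector x (rho_A G)"
    using rho_A_nonneg_eigenvector[OF G ne] by blast
  have iso: "digraph_iso (with_proj G) (with_proj (H_graph n))"
    if "matching_join D I" "card D = matching_size n"
      "card (unmatched D) = (if n mod 4 = 2 then 1 else 0)" for D I
  proof -
    obtain D' I' where mj: "simple_graph.matching_join (pverts (H_graph n)) (parcs (H_graph n)) D' I'"
      and c: "card D' = matching_size n" "card I' = n - matching_size n"
        "card (simple_graph.unmatched (parcs (H_graph n)) D') = (if n mod 4 = 2 then 1 else 0)"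
      by (rule H_graph_matching_join)
    show ?thesis
      using matching_join_nbh(5)[OF that(1)] that n c
      by (intro matching_join_iso[OF G pair_graph_H_graph that(1) mj]) auto
  qed
  show ?thesis
  proof (cases "n mod 4 = 2")
    case True
    define h where "h = n div 2"
    have h: "n = 2 * h" "odd h" "h \<ge> 3" using True n unfolding h_def by presburger+
    obtain r where r: "cubic h r = 0" "real h < r" using cubic_root[of h] h(3) by auto
    have H: "rho_A (H_graph n) = r" using rho_A_H_graph_cubic[OF h r] .
    have below: "t < r" if "cubic h t < 0" for t
      using cubic_nonneg_above_root[OF r, of t] h(3) that by force
    show ?thesis
    proof (cases "rho_A G > real h")
      case False
      then show ?thesis using H r by simp
    next
      case gt: True
      have ms: "matching_size n = h" using h(1,2) by (rule matching_size_two_mod_four)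
      from two_mod_four_dichotomy[OF _ h(2,3) x gt] n h
      consider D I where "matching_join D I" "card D = h" "card (unmatched D) = 1"
        | "cubic h (rho_A G) < 0" | "h = 3" "rho_A G \<le> 339 / 100" by auto
      then show ?thesis
      proof cases
        case 1
        then show ?thesis using iso ms True by auto
      next
        case 2
        then show ?thesis using below H by simp
      next
        case 3
        have "cubic h (339 / 100) < 0" using 3(1) by (simp add: cubic_def power2_eq_square power3_eq_cube)
        then show ?thesis using below 3(2) H by fastforce
      qed
    qed
  next
    case False
    note H = rho_A_H_graph_quadratic[OF n(2) False]
    show ?thesis
    proof (cases "rho_A G < rho_A (H_graph n)")
      case ge: False
      let ?s = "rho_A G" and ?r = "rho_A (H_graph n)"
      have "?r * (?r - 1) \<le> ?s * (?s - 1)" using ge H(1) by (intro mult_mono) auto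
      then have eq: "4 * (?s * (?s - 1)) = real ((card (pverts G))\<^sup>2 - card (pverts G) mod 2)"
        using radius_product_le(1)[OF x ne] H(2) n(1) by simp
      show ?thesis
      proof (rule extremal_structure[OF x _ eq])
        show "4 \<le> card (pverts G)" using n by simp
      next
        fix D I
        assume "matching_join D I" "unmatched D = {}" "card D = matching_size (card (pverts G))"
        then show ?thesis using iso n False by auto
      next
        fix cs
        assume cs: "distinct cs" "set cs = pverts G" "length cs = 7"
          and adj: "\<And>i j. i < 7 \<Longrightarrow> j < 7 \<Longrightarrow> cs ! j \<in> nbh (cs ! i) \<longleftrightarrow>
            j \<noteq> i \<and> j \<noteq> (i + 1) mod 7 \<and> i \<noteq> (j + 1) mod 7"
        have "n = 7" using n cs distinct_card[of cs] by simp
        moreover have "digraph_iso (with_proj G) (with_proj F_graph)"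
          using adj by (intro digraph_iso_F_graph[OF assms(1) cs]) (simp add: nbh_def)
        ultimately show ?thesis by blast
      qed
    qed simp
  qed
qed

theorem theorem1:
  fixes G :: "'a pair_pre_digraph" and n :: nat
  assumes "pair_graph G"
    and "card (pverts G) = n"
    and "n \<ge> 4"
    and "wheel_free G"
  shows "rho_A G \<le> rho_A (H_graph n) \<and>
    (rho_A G = rho_A (H_graph n) \<longleftrightarrow>
      (if n \<noteq> 7 then digraph_iso (with_proj G) (with_proj (H_graph n))
       else digraph_iso (with_proj G) (with_proj (H_graph 7)) \<or>
            digraph_iso (with_proj G) (with_proj F_graph)))"
proof -
  have isoH: "rho_A G = rho_A (H_graph n)" if "digraph_iso (with_proj G) (with_proj (H_graph n))"
    using that assms(1) by (rule rho_A_iso)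
  have isoF: "rho_A G = rho_A (H_graph 7)" if "digraph_iso (with_proj G) (with_proj F_graph)"
  proof -
    note H = rho_A_H_graph_quadratic[of 7, simplified]
    have "(rho_A (H_graph 7) - 4) * (rho_A (H_graph 7) + 3) = 0"
      using H(2) by (simp add: algebra_simps)
    then have "rho_A (H_graph 7) = 4" using H(1) by auto
    then show ?thesis using rho_A_iso[OF that assms(1)] rho_A_F_graph by simp
  qed
  from wheel_free_bound[OF assms]
  consider "rho_A G < rho_A (H_graph n)" | "digraph_iso (with_proj G) (with_proj (H_graph n))"
    | "n = 7" "digraph_iso (with_proj G) (with_proj F_graph)" by blast
  then show ?thesis
  proof cases
    case 1
    then have "rho_A G \<noteq> rho_A (H_graph n)" by simp
    then have "\<not> digraph_iso (with_proj G) (with_proj (H_graph n))"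
      "n = 7 \<longrightarrow> \<not> digraph_iso (with_proj G) (with_proj F_graph)"
      using isoH isoF by blast+
    with 1 show ?thesis by (cases "n = 7") simp_all
  next
    case 2
    then show ?thesis using isoH[OF 2] by (cases "n = 7") simp_all
  next
    case 3
    then show ?thesis using isoF[OF 3(2)] by simp
  qed
qed

end
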